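(* Let $1\le\alpha<2e$ be a real number. Then for every $\beta\in(0,1)$, the first radial $(k,\alpha k)$-eigenfunctions $u_{k,\alpha k}$ converge to $v_\alpha$ in $C^{1,\beta}([0,1])$ as $k\to\infty$.
   Context: For real $0\le k\le n$, $\binom{n}{k}:=\frac{\Gamma(n+1)}{\Gamma(k+1)\Gamma(n-k+1)}$. For $\alpha\ge 1$, a function $u\in C^2(0,1)$ is called $\alpha$-convex if $\limsup_{r\to0}\frac{u'}{r}<\infty$, $u'\ge0$ and $u''+(\alpha-1)\frac{u'}{r}\ge0$ on $(0,1)$. For real $1\le k\le n$, set $\alpha=n/k$ and $S_{k,n}(u):=\binom{n-1}{k-1}\left(\frac{u'}{r}\right)^{k-1}\left(u''+\frac{n-k}{k}\frac{u'}{r}\right)$. An $\alpha$-convex function $u$ and a number $\lambda>0$ solve the radial $(k,n)$-eigenvalue problem if $S_{k,n}(u)=(-\lambda u)^k$ on $(0,1)$, $u(0)=-1$, $u(1)=0$ (endpoint values taken as limits). It is known that there is a unique such pair, denoted $(u_{k,n},\lambda_{k,n})$: the first radial $(k,n)$-eigenfunction and eigenvalue. It is also known that $\lambda_{k,n}^k=\inf\frac{E_{k,n}[u]}{I_{k,n}[u]}$, the infimum being over $\alpha$-convex $u$ with $u(1)=0$, $u(0)=-1$, where $E_{k,n}[u]=\frac1{k+1}\int_0^1(-u)S_{k,n}(u)\,r^{n-1}dr$ and $I_{k,n}[u]=\frac1{k+1}\int_0^1(-u)^{k+1}r^{n-1}dr$; the infimum is attained by $u_{k,n}$. The function $v_\alpha:[0,1]\to\mathbb{R}$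 is defined as follows. For $\alpha\ne2$, let $r_\alpha:=\left(\frac{\alpha}{2}\right)^{\frac1{2-\alpha}}$, $A_\alpha:=\frac{2}{2-\alpha}e^{-\alpha/2}$, and \[ v_\alpha(r):=\begin{cases}-e^{-\frac{\alpha r^2}{2r_\alpha^2}}&0\le r\le r_\alpha,\\ A_\alpha(r^{2-\alpha}-1)& r_\alpha<r\le1.\end{cases} \] For $\alpha=2$, $v_2(r):=-e^{-er^2}$ for $0\le r\le e^{-1/2}$ and $v_2(r):=2e^{-1}\log r$ for $e^{-1/2}<r\le1$. *)

theory Defs
  imports "HOL-Analysis.Analysis"
begin

definition real_binomial :: "real \<Rightarrow> real \<Rightarrow> real" where
  "real_binomial n k = Gamma (n + 1) / (Gamma (k + 1) * Gamma (n - k + 1))"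

(* In HOL, 0 powr 0 = 0.  The convention x^0 = 1 is needed for the factor (u'/r)^(k-1) at k = 1. *)
definition real_power :: "real \<Rightarrow> real \<Rightarrow> real" where
  "real_power x a = (if a = 0 then 1 else x powr a)"

definition C2_on_unit_interval :: "(real \<Rightarrow> real) \<Rightarrow> bool" where
  "C2_on_unit_interval u \<longleftrightarrow>
     (\<forall>r\<in>{0<..<1}. u differentiable (at r)) \<and>
     (\<forall>r\<in>{0<..<1}. deriv u differentiable (at r)) \<and>
     continuous_on {0<..<1} (deriv (deriv u))"

definition alpha_convex :: "real \<Rightarrow> (real \<Rightarrow> real) \<Rightarrow> bool" where
  "alpha_convex \<alpha> u \<longleftrightarrow>
     C2_on_unit_interval u \<and>
     Limsup (at_right 0) (\<lambda>r. ereal (deriv u r / r)) < \<infinity> \<and>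
     (\<forall>r\<in>{0<..<1}. deriv u r \<ge> 0) \<and>
     (\<forall>r\<in>{0<..<1}. deriv (deriv u) r + (\<alpha> - 1) * (deriv u r / r) \<ge> 0)"

definition S_op :: "real \<Rightarrow> real \<Rightarrow> (real \<Rightarrow> real) \<Rightarrow> real \<Rightarrow> real" where
  "S_op k n u r =
     real_binomial (n - 1) (k - 1) * real_power (deriv u r / r) (k - 1) *
     (deriv (deriv u) r + (n - k) / k * (deriv u r / r))"

(* The boundary values are limits of u from inside (0,1).  The conditions u 0 = -1 and u 1 = 0
   only say that u, a total function in HOL, is represented on [0,1] by its continuous extension. *)
definition radial_eigenpair :: "real \<Rightarrow> real \<Rightarrow> (real \<Rightarrow> real) \<Rightarrow> real \<Rightarrow> bool" where
  "radial_eigenpair k n u lam \<longleftrightarrow>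
     alpha_convex (n / k) u \<and> lam > 0 \<and>
     (\<forall>r\<in>{0<..<1}. S_op k n u r = real_power (- lam * u r) k) \<and>
     (u \<longlongrightarrow> -1) (at_right 0) \<and> u 0 = -1 \<and>
     (u \<longlongrightarrow> 0) (at_left 1) \<and> u 1 = 0"

definition r_crit :: "real \<Rightarrow> real" where
  "r_crit \<alpha> = (\<alpha> / 2) powr (1 / (2 - \<alpha>))"

definition A_coeff :: "real \<Rightarrow> real" where
  "A_coeff \<alpha> = 2 / (2 - \<alpha>) * exp (- \<alpha> / 2)"

definition v_lim :: "real \<Rightarrow> real \<Rightarrow> real" where
  "v_lim \<alpha> r =
     (if \<alpha> = 2 then
        (if r \<le> exp (- 1 / 2) then - exp (- exp 1 * r\<^sup>2) else 2 * exp (- 1) * ln r)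
      else
        (if r \<le> r_crit \<alpha> then - exp (- (\<alpha> * r\<^sup>2 / (2 * (r_crit \<alpha>)\<^sup>2)))
         else A_coeff \<alpha> * (r powr (2 - \<alpha>) - 1)))"

definition sup_norm_on :: "real set \<Rightarrow> (real \<Rightarrow> real) \<Rightarrow> ennreal" where
  "sup_norm_on S f = (SUP x\<in>S. ennreal \<bar>f x\<bar>)"

definition holder_seminorm_on :: "real set \<Rightarrow> real \<Rightarrow> (real \<Rightarrow> real) \<Rightarrow> ennreal" where
  "holder_seminorm_on S \<beta> f =
     (SUP (x, y)\<in>{(x, y). x \<in> S \<and> y \<in> S \<and> x \<noteq> y}. ennreal (\<bar>f x - f y\<bar> / \<bar>x - y\<bar> powr \<beta>))"

(* One-sided at the endpoints of a closed interval S. *)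
abbreviation deriv_within :: "real set \<Rightarrow> (real \<Rightarrow> real) \<Rightarrow> real \<Rightarrow> real" where
  "deriv_within S f x \<equiv> vector_derivative f (at x within S)"

definition C1_holder_norm :: "real set \<Rightarrow> real \<Rightarrow> (real \<Rightarrow> real) \<Rightarrow> ennreal" where
  "C1_holder_norm S \<beta> f =
     sup_norm_on S f + sup_norm_on S (deriv_within S f) + holder_seminorm_on S \<beta> (deriv_within S f)"

definition C1_holder_space :: "real set \<Rightarrow> real \<Rightarrow> (real \<Rightarrow> real) set" where
  "C1_holder_space S \<beta> =
     {f. f differentiable_on S \<and> continuous_on S (deriv_within S f) \<and> C1_holder_norm S \<beta> f < \<infinity>}"

definition C1_holder_converges ::
    "real set \<Rightarrow> real \<Rightarrow> ('a \<Rightarrow> real \<Rightarrow> real) \<Rightarrow> (real \<Rightarrow> real) \<Rightarrow> 'a filter \<Rightarrow> bool" where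
  "C1_holder_converges S \<beta> f g F \<longleftrightarrow>
     (\<forall>\<^sub>F k in F. f k \<in> C1_holder_space S \<beta>) \<and> g \<in> C1_holder_space S \<beta> \<and>
     ((\<lambda>k. C1_holder_norm S \<beta> (\<lambda>x. f k x - g x)) \<longlongrightarrow> 0) F"

end

theory Submission
  imports Defs
begin

text \<open>
  With \<open>n = \<alpha> k\<close> and \<open>w = r powr (\<alpha> - 1) * u'\<close> the eigenvalue equation reads
  \<open>(w powr k)' = (Lam * (- u)) powr k * r powr (\<alpha> * k - 1)\<close>, where \<open>Lam\<close> is the eigenvalue divided
  by the \<open>k\<close>-th root of the normalising constant. Integrating from \<open>0\<close> and taking \<open>k\<close>-th roots,
  \<open>w r\<close> agrees with \<open>Lam * (SUP s\<in>{0<..r}. s powr \<alpha> * (- u s))\<close> up to an error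
  \<open>o(1) * Lam * r powr \<alpha>\<close> as \<open>k \<rightarrow> \<infinity>\<close>, uniformly in \<open>r\<close>, because \<open>- u\<close> is nonincreasing with values in \<open>[0, 1]\<close>.
  In the limit this is a Volterra-type equation with Lipschitz right-hand side, and the rescaled
  profiles \<open>v_lim \<alpha> (\<rho> * r)\<close> solve it, with \<open>\<rho>\<close> determined by \<open>Lam\<close>. Hence \<open>u\<close> and \<open>u'\<close> are uniformly
  close to such a profile, the condition \<open>u 1 = 0\<close> forces \<open>\<rho> \<rightarrow> 1\<close>, and the uniform bound
  \<open>\<bar>u''\<bar> \<le> \<alpha> * Lam\<close> upgrades uniform convergence of \<open>u'\<close> to convergence in every Hoelder norm.
\<close>

section \<open>One-dimensional calculus\<close>

text \<open>Stands in for integrating the equation from the left endpoint, where only a limit of the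
  function is known. Monotonicity on \<open>{s..b}\<close> passes to the limit in
  \<open>s\<close>.\<close>

lemma le_of_nonneg_deriv_right_limit:
  fixes g g' :: "real \<Rightarrow> real"
  assumes lim: "(g \<longlongrightarrow> l) (at_right a)" and "a < b"
    and der: "\<And>x. a < x \<Longrightarrow> x \<le> b \<Longrightarrow> (g has_real_derivative g' x) (at x)"
    and nonneg: "\<And>x. a < x \<Longrightarrow> x \<le> b \<Longrightarrow> 0 \<le> g' x"
  shows "l \<le> g b"
proof (rule tendsto_upperbound[OF lim])
  show "\<forall>\<^sub>F s in at_right a. g s \<le> g b"
    using eventually_at_right_real[OF \<open>a < b\<close>]
  proof eventually_elim
    case (elim s)
    show ?case
      by (rule DERIV_nonneg_imp_nondecreasing) (use elim der nonneg in \<open>force+\<close>)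
  qed
qed simp

lemma has_real_derivative_const_powr:
  fixes a C s :: real
  assumes "0 < s" "a \<noteq> 0"
  shows "((\<lambda>s. C / a * s powr a) has_real_derivative C * s powr (a - 1)) (at s)"
  using DERIV_cmult[OF has_real_derivative_powr[OF \<open>0 < s\<close>, of a], of "C / a"] assms by simp

lemma powr_lim_0:
  assumes "0 < a"
  shows "((\<lambda>r::real. b * r powr a) \<longlongrightarrow> 0) (at_right 0)"
proof -
  have "((\<lambda>r::real. b * r powr a) \<longlongrightarrow> b * 0 powr a) (at_right 0)"
    using assms by (intro tendsto_intros) (auto simp: eventually_at_right_field intro: exI[of _ 1])
  then show ?thesis by simp
qed

lemma lipschitz_on_of_bounded_derivative:
  fixes f f' :: "real \<Rightarrow> real"
  assumes "convex S" "0 \<le> B"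
    and "\<And>x. x \<in> S \<Longrightarrow> (f has_real_derivative f' x) (at x within S)"
    and "\<And>x. x \<in> S \<Longrightarrow> \<bar>f' x\<bar> \<le> B"
  shows "B-lipschitz_on S f"
proof (rule lipschitz_onI)
  fix x y assume "x \<in> S" "y \<in> S"
  with assms show "dist (f x) (f y) \<le> B * dist x y"
    using field_differentiable_bound[of S f f' B x y] by (simp add: dist_norm)
qed fact

lemma has_real_derivative_from_sides:
  fixes f :: "real \<Rightarrow> real"
  assumes "(f has_real_derivative d) (at x within {..x})" "(f has_real_derivative d) (at x within {x..})"
  shows "(f has_real_derivative d) (at x)"
proof -
  have "{..x} \<union> {x..} = UNIV" by auto
  then show ?thesis
    using assms unfolding has_field_derivative_iff by (intro Lim_Un_univ)
qed

text \<open>A Lipschitz derivative extends to the closed interval, and \<open>f\<close> differs from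
  the primitive of the extension by a constant. This supplies the one-sided derivatives at the
  endpoints, about which the equation on the open interval says nothing.\<close>

lemma derivative_extends_to_closed_interval:
  fixes f f' :: "real \<Rightarrow> real"
  assumes "a < b" and cont: "continuous_on {a..b} f"
    and der: "\<And>x. x \<in> {a<..<b} \<Longrightarrow> (f has_real_derivative f' x) (at x)"
    and lip: "L-lipschitz_on {a<..<b} f'"
  obtains g where "L-lipschitz_on {a..b} g" "\<And>x. x \<in> {a<..<b} \<Longrightarrow> g x = f' x"
    "\<And>x. x \<in> {a..b} \<Longrightarrow> (f has_vector_derivative g x) (at x within {a..b})"
proof -
  obtain g where g: "L-lipschitz_on {a..b} g" "\<And>x. x \<in> {a<..<b} \<Longrightarrow> g x = f' x"
    using lipschitz_extend_closure[OF lip] \<open>a < b\<close> by auto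
  define G where "G = (\<lambda>x. integral {a..x} g)"
  have G: "(G has_vector_derivative g x) (at x within {a..b})" if "x \<in> {a..b}" for x
    unfolding G_def
    by (rule integral_has_vector_derivative[OF lipschitz_on_continuous_on[OF g(1)] that])
  have G': "(G has_real_derivative g x) (at x)" if "a < x" "x < b" for x
    using G[of x] that at_within_Icc_at[of a x b]
    by (simp add: has_real_derivative_iff_has_vector_derivative)
  have "continuous_on {a..b} G"
    using G by (meson continuous_on_eq_continuous_within has_vector_derivative_continuous)
  then have "f x - G x = f a - G a" if "x \<in> {a..b}" for x
    using that \<open>a < b\<close> cont der g(2) DERIV_diff[OF der G']
    by (intro DERIV_isconst2[of a b "\<lambda>x. f x - G x"] continuous_on_diff) auto
  then have eq: "f x = G x + (f a - G a)" if "x \<in> {a..b}" for x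
    using that by (simp add: algebra_simps)
  have "(f has_vector_derivative g x) (at x within {a..b})" if "x \<in> {a..b}" for x
  proof (rule has_vector_derivative_transform[OF that eq])
    show "((\<lambda>x. G x + (f a - G a)) has_vector_derivative g x) (at x within {a..b})"
      using has_vector_derivative_add[OF G[OF that] has_vector_derivative_const] by simp
  qed
  with g show thesis by (rule that)
qed

text \<open>Split \<open>d\<close> as \<open>d powr (1 - \<beta>) * d powr \<beta>\<close>, bound
  the first factor by the sup bound \<open>e\<close> and the second by the Lipschitz bound
  \<open>L * h\<close>.\<close>

lemma holder_interpolation:
  fixes d h e L \<beta> :: real
  assumes "0 \<le> d" "d \<le> e" "d \<le> L * h" "0 < h" "0 \<le> L" "0 < \<beta>" "\<beta> < 1"
  shows "d / h powr \<beta> \<le> e powr (1 - \<beta>) * L powr \<beta>"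
proof (cases "d = 0")
  case False
  have "d = d powr (1 - \<beta>) * d powr \<beta>"
    using assms False by (simp flip: powr_add)
  also have "\<dots> \<le> e powr (1 - \<beta>) * (L * h) powr \<beta>"
    using assms by (intro mult_mono powr_mono2) auto
  finally show ?thesis using assms by (simp add: powr_mult divide_le_eq mult.assoc)
qed simp

lemma powr_inverse_tendsto_1:
  fixes \<alpha> :: real
  assumes "1 \<le> \<alpha>"
  shows "((\<lambda>k. (\<alpha> * k) powr (1 / k)) \<longlongrightarrow> 1) at_top"
proof -
  have "((\<lambda>k::real. exp (ln \<alpha> * inverse k + ln k / k)) \<longlongrightarrow> exp (ln \<alpha> * 0 + 0)) at_top"
    by (intro tendsto_intros ln_x_over_x_tendsto_0 tendsto_inverse_0_at_top filterlim_ident)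
  then have "((\<lambda>k::real. exp (ln \<alpha> * inverse k + ln k / k)) \<longlongrightarrow> 1) at_top" by simp
  then show ?thesis
  proof (rule Lim_transform_eventually)
    show "\<forall>\<^sub>F k in at_top. exp (ln \<alpha> * inverse k + ln k / k) = (\<alpha> * k) powr (1 / k)"
      using eventually_gt_at_top[of 0]
      by eventually_elim (use assms in \<open>simp add: powr_def ln_mult field_simps\<close>)
  qed
qed

section \<open>Radial eigenfunctions\<close>

text \<open>Convergence concerns large \<open>k\<close> only. With \<open>1 < k\<close> the
  exponents \<open>k - 1\<close> and \<open>k\<close> are nonzero, so \<open>real_power\<close> is
  \<open>powr\<close>.\<close>

locale radial_eigenfunction =
  fixes \<alpha> k :: real and u :: "real \<Rightarrow> real" and lam :: real
  assumes alpha: "1 \<le> \<alpha>" and k: "1 < k" and eigenpair: "radial_eigenpair k (\<alpha> * k) u lam"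
begin

text \<open>The factor \<open>k\<close> is split off the binomial because differentiating
  \<open>w powr k\<close> produces it again; \<open>c\<close> is what remains to be absorbed into
  \<open>Lam\<close>.\<close>

definition c :: real where "c = real_binomial (\<alpha> * k - 1) (k - 1) / k"

definition Lam :: real where "Lam = lam * c powr (- (1 / k))"

definition w :: "real \<Rightarrow> real" where "w r = r powr (\<alpha> - 1) * deriv u r"

lemma lam_pos: "0 < lam"
  using eigenpair by (simp add: radial_eigenpair_def)

lemma c_pos: "0 < c"
proof -
  have "k \<le> \<alpha> * k" using alpha k by simp
  then show ?thesis
    using k unfolding c_def real_binomial_def
    by (intro divide_pos_pos mult_pos_pos Gamma_real_pos) linarith+
qed

lemma Lam_pos: "0 < Lam"
  using lam_pos c_pos by (simp add: Lam_def)

lemma Lam_powr: "Lam powr k = lam powr k / c"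
proof -
  have "(c powr (- (1 / k))) powr k = 1 / c"
    using c_pos k by (simp only: powr_powr) (simp add: powr_minus_divide)
  then show ?thesis
    by (simp add: Lam_def powr_mult del: powr_minus)
qed

lemma alpha_convex: "alpha_convex \<alpha> u"
  using eigenpair k by (simp add: radial_eigenpair_def)

lemma u_deriv: "r \<in> {0<..<1} \<Longrightarrow> (u has_real_derivative deriv u r) (at r)"
  using alpha_convex by (simp add: alpha_convex_def C2_on_unit_interval_def DERIV_deriv_iff_real_differentiable)

lemma u_deriv2: "r \<in> {0<..<1} \<Longrightarrow> (deriv u has_real_derivative deriv (deriv u) r) (at r)"
  using alpha_convex by (simp add: alpha_convex_def C2_on_unit_interval_def DERIV_deriv_iff_real_differentiable)

lemma deriv_u_nonneg: "r \<in> {0<..<1} \<Longrightarrow> 0 \<le> deriv u r"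
  using alpha_convex by (simp add: alpha_convex_def)

lemma w_deriv:
  assumes "r \<in> {0<..<1}"
  shows "(w has_real_derivative
    r powr (\<alpha> - 1) * (deriv (deriv u) r + (\<alpha> - 1) * (deriv u r / r))) (at r)"
proof -
  have "((\<lambda>r. r powr (\<alpha> - 1) * deriv u r) has_real_derivative
      ((\<alpha> - 1) * r powr (\<alpha> - 1 - 1)) * deriv u r + deriv (deriv u) r * r powr (\<alpha> - 1)) (at r)"
    using assms by (intro DERIV_mult has_real_derivative_powr u_deriv2) auto
  moreover have "r powr (\<alpha> - 1 - 1) = r powr (\<alpha> - 1) / r"
    using assms by (simp add: powr_diff power2_eq_square)
  ultimately show ?thesis
    unfolding w_def[abs_def] by (simp add: algebra_simps diff_divide_distrib)
qed

text \<open>The second-order condition of \<alpha>-convexity says exactly that \<open>w\<close> has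
  nonnegative derivative.\<close>

lemma w_mono:
  assumes "0 < s" "s \<le> r" "r < 1"
  shows "w s \<le> w r"
proof (rule DERIV_nonneg_imp_nondecreasing[of s r w])
  fix x assume x: "s \<le> x" "x \<le> r"
  then have "0 \<le> x powr (\<alpha> - 1) * (deriv (deriv u) x + (\<alpha> - 1) * (deriv u x / x))"
    using alpha_convex assms by (simp add: alpha_convex_def)
  then show "\<exists>y. DERIV w x :> y \<and> 0 \<le> y"
    using w_deriv[of x] assms x by auto
qed fact

lemma eigen_ode:
  assumes "r \<in> {0<..<1}"
  shows "c * k * (deriv u r / r) powr (k - 1) * (deriv (deriv u) r + (\<alpha> - 1) * (deriv u r / r))
    = (lam * (- u r)) powr k"
proof -
  have "(\<alpha> * k - k) / k = \<alpha> - 1" using k by (simp add: field_simps)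
  moreover have "S_op k (\<alpha> * k) u r = real_power (- lam * u r) k"
    using eigenpair assms by (simp add: radial_eigenpair_def)
  ultimately show ?thesis
    using k by (simp add: S_op_def real_power_def c_def)
qed

section \<open>Boundary values, strict monotonicity and sign of the eigenfunction\<close>

lemma u_lim_0: "(u \<longlongrightarrow> -1) (at_right 0)" and u_lim_1: "(u \<longlongrightarrow> 0) (at_left 1)"
  and u_0: "u 0 = -1" and u_1: "u 1 = 0"
  using eigenpair by (simp_all add: radial_eigenpair_def)

text \<open>If \<open>u'\<close> vanished at \<open>r\<close>, monotonicity would make
  \<open>w\<close> vanish on all of \<open>(0, r]\<close>; the equation would then give
  \<open>u = 0\<close> there, against the limit -1 at 0. Strict positivity is what allows real
  powers of \<open>w\<close> to be split and cancelled later.\<close>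

lemma deriv_u_pos:
  assumes r: "r \<in> {0<..<1}"
  shows "0 < deriv u r"
proof (rule ccontr)
  assume "\<not> 0 < deriv u r"
  then have "w r = 0" using deriv_u_nonneg[OF r] by (simp add: w_def)
  have zero: "u s = 0" if s: "s \<in> {0<..<r}" for s
  proof -
    have s': "s \<in> {0<..<1}" using s r by auto
    have "w s \<le> 0" using w_mono[of s r] s r \<open>w r = 0\<close> by simp
    then have "deriv u s = 0"
      using deriv_u_nonneg[OF s'] s by (simp add: w_def mult_le_0_iff)
    with eigen_ode[OF s'] have "(lam * (- u s)) powr k = 0" by simp
    then show ?thesis using lam_pos by simp
  qed
  have "(u \<longlongrightarrow> 0) (at_right 0)"
    by (rule tendsto_eventually, rule eventually_mono[OF eventually_at_right_real[of 0 r]])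
      (use r zero in auto)
  then show False
    using tendsto_unique[OF _ u_lim_0, of 0] by simp
qed

lemma u_less:
  assumes "0 < s" "s < r" "r < 1"
  shows "u s < u r"
proof (rule DERIV_pos_imp_increasing[OF \<open>s < r\<close>])
  fix x assume "s \<le> x" "x \<le> r"
  then show "\<exists>y. DERIV u x :> y \<and> 0 < y"
    using u_deriv[of x] deriv_u_pos[of x] assms by auto
qed

lemma u_neg:
  assumes "r \<in> {0<..<1}"
  shows "u r < 0"
proof -
  \<comment> \<open>The limit at 1 gives only \<open>u t \<le> 0\<close>; a point strictly between
    \<open>r\<close> and 1 restores strictness.\<close>
  obtain t where t: "r < t" "t < 1" using assms dense[of r 1] by auto
  have "u t \<le> 0"
  proof (rule tendsto_lowerbound[OF u_lim_1])
    show "\<forall>\<^sub>F s in at_left 1. u t \<le> u s"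
      using eventually_at_left_real[OF \<open>t < 1\<close>]
      by eventually_elim (use u_less[of t] assms t in force)
  qed simp
  then show ?thesis using u_less[of r t] assms t by simp
qed

lemma u_ge_minus_1:
  assumes "r \<in> {0<..<1}"
  shows "-1 \<le> u r"
  using u_lim_0 assms
  by (intro le_of_nonneg_deriv_right_limit[of u "-1" 0 r "deriv u"] u_deriv deriv_u_nonneg) auto

lemma continuous_on_u: "continuous_on {0..1} u"
proof (rule continuous_on_IccI)
  show "(u \<longlongrightarrow> u 0) (at_right 0)" "(u \<longlongrightarrow> u 1) (at_left 1)"
    using u_lim_0 u_lim_1 by (simp_all add: u_0 u_1)
  show "\<And>x. 0 < x \<Longrightarrow> x < 1 \<Longrightarrow> u \<midarrow>x\<rightarrow> u x"
    using u_deriv by (auto simp flip: isCont_def intro: DERIV_isCont)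
qed simp

section \<open>The equation for \<open>w powr k\<close> and two-sided bounds for
  \<open>w\<close>\<close>

lemma w_pos: "r \<in> {0<..<1} \<Longrightarrow> 0 < w r"
  using deriv_u_pos by (simp add: w_def)

text \<open>Multiplying the equation by \<open>r powr (\<alpha> * k - 1)\<close> makes its left side
  the exact derivative of \<open>w powr k\<close>.\<close>

lemma eigen_ode_w:
  assumes r: "r \<in> {0<..<1}"
  shows "k * w r powr (k - 1) *
      (r powr (\<alpha> - 1) * (deriv (deriv u) r + (\<alpha> - 1) * (deriv u r / r)))
    = (Lam * (- u r)) powr k * r powr (\<alpha> * k - 1)"
proof -
  let ?z = "deriv (deriv u) r + (\<alpha> - 1) * (deriv u r / r)"
  have "w r powr (k - 1) = (deriv u r / r) powr (k - 1) * r powr (\<alpha> * (k - 1))"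
    using r deriv_u_pos[OF r] unfolding w_def
    by (simp add: powr_mult powr_divide powr_powr powr_diff divide_simps flip: powr_add)
      (simp add: algebra_simps powr_diff powr_add)
  then have "k * w r powr (k - 1) * (r powr (\<alpha> - 1) * ?z)
      = (k * (deriv u r / r) powr (k - 1) * ?z) * (r powr (\<alpha> * (k - 1)) * r powr (\<alpha> - 1))"
    by (simp only: mult_ac)
  also have "r powr (\<alpha> * (k - 1)) * r powr (\<alpha> - 1) = r powr (\<alpha> * k - 1)"
    by (simp add: algebra_simps flip: powr_add)
  also have "k * (deriv u r / r) powr (k - 1) * ?z = (Lam * (- u r)) powr k"
  proof -
    have "(lam * (- u r)) powr k = c * (Lam * (- u r)) powr k"
      using c_pos by (simp only: powr_mult Lam_powr) simp
    with eigen_ode[OF r] c_pos show ?thesis by (simp add: mult.assoc)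
  qed
  finally show ?thesis .
qed

lemma w_powr_deriv:
  assumes r: "r \<in> {0<..<1}"
  shows "((\<lambda>r. w r powr k) has_real_derivative (Lam * (- u r)) powr k * r powr (\<alpha> * k - 1)) (at r)"
  unfolding eigen_ode_w[OF r, symmetric]
  using has_real_derivative_powr[of "w r" k] w_pos[OF r]
  by (intro DERIV_chain2[OF _ w_deriv[OF r], of "\<lambda>x. x powr k"]) simp

lemma eventually_w_nonneg: "\<forall>\<^sub>F r in at_right 0. 0 \<le> w r"
  using eventually_at_right_real[OF zero_less_one] by eventually_elim (use w_pos in force)

text \<open>The Limsup condition bounds \<open>u' / r\<close> by some \<open>b\<close> near 0, hence
  \<open>w\<close> by \<open>b * r powr \<alpha>\<close>.\<close>

lemma w_lim_0: "(w \<longlongrightarrow> 0) (at_right 0)"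
proof -
  have "Limsup (at_right 0) (\<lambda>r. ereal (deriv u r / r)) < \<infinity>"
    using alpha_convex by (simp add: alpha_convex_def)
  then obtain B :: ereal where "Limsup (at_right 0) (\<lambda>r. ereal (deriv u r / r)) < B" "B < \<infinity>"
    using dense by blast
  then obtain b where b: "\<forall>\<^sub>F r in at_right 0. deriv u r / r < b"
    by (cases B) (auto dest: Limsup_lessD)
  show ?thesis
  proof (rule tendsto_sandwich)
    show "\<forall>\<^sub>F r in at_right 0. 0 \<le> w r" by (rule eventually_w_nonneg)
    show "\<forall>\<^sub>F r in at_right 0. w r \<le> r powr \<alpha> * b"
      using b eventually_at_right_real[of 0 "1::real", OF zero_less_one]
    proof eventually_elim
      case (elim r)
      then have "w r = r powr \<alpha> * (deriv u r / r)" by (simp add: w_def powr_diff)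
      then show ?case using elim by (metis less_imp_le mult_left_mono powr_ge_zero)
    qed
    have "((\<lambda>r::real. r powr \<alpha> * b) \<longlongrightarrow> 0 powr \<alpha> * b) (at_right 0)"
      using alpha by (intro tendsto_intros) (auto simp: eventually_at_right_field intro: exI[of _ 1])
    then show "((\<lambda>r. r powr \<alpha> * b) \<longlongrightarrow> 0) (at_right 0)" by simp
  qed simp
qed

lemma w_powr_lim_0: "((\<lambda>r. w r powr k) \<longlongrightarrow> 0) (at_right 0)"
proof -
  have "((\<lambda>r. w r powr k) \<longlongrightarrow> 0 powr k) (at_right 0)"
  proof (rule tendsto_powr2[OF w_lim_0 tendsto_const])
    show "\<forall>\<^sub>F r in at_right 0. 0 \<le> w r" by (rule eventually_w_nonneg)
  qed (use k in simp)
  then show ?thesis by simp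
qed

lemma w_powr_ge:
  assumes r: "r \<in> {0<..<1}"
  shows "(Lam * (- u r)) powr k * r powr (\<alpha> * k) / (\<alpha> * k) \<le> w r powr k"
proof -
  let ?C = "(Lam * (- u r)) powr k"
  have "0 \<le> w r powr k - ?C / (\<alpha> * k) * r powr (\<alpha> * k)"
  proof (rule le_of_nonneg_deriv_right_limit
      [where a = 0 and b = r and g = "\<lambda>s. w s powr k - ?C / (\<alpha> * k) * s powr (\<alpha> * k)"])
    show "((\<lambda>s. w s powr k - ?C / (\<alpha> * k) * s powr (\<alpha> * k)) \<longlongrightarrow> 0) (at_right 0)"
      using tendsto_diff[OF w_powr_lim_0 powr_lim_0[of "\<alpha> * k" "?C / (\<alpha> * k)"]] alpha k by simp
    fix s assume s: "0 < s" "s \<le> r"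
    then have s': "s \<in> {0<..<1}" using r by auto
    show "((\<lambda>s. w s powr k - ?C / (\<alpha> * k) * s powr (\<alpha> * k)) has_real_derivative
        (Lam * (- u s)) powr k * s powr (\<alpha> * k - 1) - ?C * s powr (\<alpha> * k - 1)) (at s)"
      using s' alpha k by (intro DERIV_diff w_powr_deriv has_real_derivative_const_powr) auto
    have "u s \<le> u r" using u_less[of s r] s r by (cases "s = r") auto
    then have "?C \<le> (Lam * (- u s)) powr k"
      using Lam_pos u_neg[OF r] k by (intro powr_mono2 mult_nonneg_nonneg mult_left_mono) auto
    then show "0 \<le> (Lam * (- u s)) powr k * s powr (\<alpha> * k - 1) - ?C * s powr (\<alpha> * k - 1)"
      by (simp add: mult_right_mono)
  qed (use r in simp)
  then show ?thesis by simp
qed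

text \<open>Take the \<open>k\<close>-th root of the preceding bound at \<open>s\<close>, then move
  from \<open>s\<close> to \<open>r\<close> by monotonicity of \<open>w\<close>. The loss is a
  factor that tends to 1.\<close>

lemma w_ge:
  assumes "0 < s" "s \<le> r" "r < 1"
  shows "Lam * (s powr \<alpha> * (- u s)) \<le> w r * (\<alpha> * k) powr (1 / k)"
proof -
  have s: "s \<in> {0<..<1}" using assms by auto
  have n: "0 < \<alpha> * k" using alpha k by simp
  have "(Lam * (s powr \<alpha> * (- u s))) powr k = (Lam * (- u s)) powr k * s powr (\<alpha> * k)"
    by (simp only: powr_mult powr_powr mult_ac)
  also have "\<dots> \<le> w s powr k * (\<alpha> * k)"
    using w_powr_ge[OF s] n by (simp add: field_simps)
  also have "\<dots> = (w s * (\<alpha> * k) powr (1 / k)) powr k"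
    using w_pos[OF s] n k by (simp add: powr_mult[of "w s"] powr_powr)
  finally have "Lam * (s powr \<alpha> * (- u s)) \<le> w s * (\<alpha> * k) powr (1 / k)"
    using w_pos[OF s] k
    by (smt (verit) mult_nonneg_nonneg powr_ge_zero powr_less_mono2)
  also have "\<dots> \<le> w r * (\<alpha> * k) powr (1 / k)"
    using w_mono[OF assms] by (simp add: mult_right_mono)
  finally show ?thesis .
qed

text \<open>With \<open>f = s powr \<alpha> * (- u s)\<close> the derivative of
  \<open>w powr k\<close> is \<open>Lam powr k * f powr k / s\<close>. Bounding all \<open>k\<close>
  factors \<open>f\<close> by the constant \<open>r powr \<alpha> * B\<close> would leave the
  non-integrable \<open>1 / s\<close>. So only \<open>k - 1\<close> of them are bounded this way and
  the last one by \<open>s powr \<alpha>\<close>, which costs the exponent \<open>1 - 1 / k\<close>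
  on \<open>B\<close>.\<close>

lemma w_le:
  assumes r: "r \<in> {0<..<1}"
    and B: "\<And>s. 0 < s \<Longrightarrow> s \<le> r \<Longrightarrow> s powr \<alpha> * (- u s) \<le> r powr \<alpha> * B"
  shows "w r \<le> Lam * r powr \<alpha> * B powr (1 - 1 / k)"
proof -
  have "0 < r powr \<alpha> * (- u r)" using r u_neg[OF r] by (intro mult_pos_pos) auto
  also have "\<dots> \<le> r powr \<alpha> * B" using B[of r] r by simp
  finally have "0 < B" using r by (simp add: zero_less_mult_iff)
  let ?C = "Lam powr k * (r powr \<alpha> * B) powr (k - 1)"
  have "0 \<le> ?C / \<alpha> * r powr \<alpha> - w r powr k"
  proof (rule le_of_nonneg_deriv_right_limit
      [where a = 0 and b = r and g = "\<lambda>s. ?C / \<alpha> * s powr \<alpha> - w s powr k"])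
    show "((\<lambda>s. ?C / \<alpha> * s powr \<alpha> - w s powr k) \<longlongrightarrow> 0) (at_right 0)"
      using tendsto_diff[OF powr_lim_0[of \<alpha> "?C / \<alpha>"] w_powr_lim_0] alpha by simp
    fix s assume s: "0 < s" "s \<le> r"
    then have s': "s \<in> {0<..<1}" using r by auto
    show "((\<lambda>s. ?C / \<alpha> * s powr \<alpha> - w s powr k) has_real_derivative
        ?C * s powr (\<alpha> - 1) - (Lam * (- u s)) powr k * s powr (\<alpha> * k - 1)) (at s)"
      using s' alpha by (intro DERIV_diff w_powr_deriv has_real_derivative_const_powr) auto
    let ?f = "s powr \<alpha> * (- u s)"
    have f: "0 < ?f" using s u_neg[OF s'] by (intro mult_pos_pos) auto
    have "?f powr k = ?f powr (k - 1) * ?f"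
      using f by (simp add: powr_diff)
    also have "\<dots> \<le> (r powr \<alpha> * B) powr (k - 1) * s powr \<alpha>"
    proof (rule mult_mono)
      show "?f powr (k - 1) \<le> (r powr \<alpha> * B) powr (k - 1)"
        using f B[OF s] k by (intro powr_mono2) auto
      have "s powr \<alpha> * (- u s) \<le> s powr \<alpha> * 1"
        using u_ge_minus_1[OF s'] by (intro mult_left_mono) auto
      then show "?f \<le> s powr \<alpha>" by simp
    qed (use f in auto)
    finally have "?f powr k / s \<le> (r powr \<alpha> * B) powr (k - 1) * s powr \<alpha> / s"
      using s by (simp add: divide_right_mono)
    then have "Lam powr k * (?f powr k / s) \<le> Lam powr k * ((r powr \<alpha> * B) powr (k - 1) * s powr \<alpha> / s)"
      by (rule mult_left_mono) simp
    moreover have "(Lam * (- u s)) powr k * s powr (\<alpha> * k - 1) = Lam powr k * (?f powr k / s)"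
      using s by (simp only: powr_mult) (simp add: powr_diff powr_powr)
    ultimately show "0 \<le> ?C * s powr (\<alpha> - 1) - (Lam * (- u s)) powr k * s powr (\<alpha> * k - 1)"
      using s by (simp add: powr_diff)
  qed (use r in simp)
  then have "w r powr k \<le> ?C * r powr \<alpha> / \<alpha>" by simp
  also have "\<dots> \<le> ?C * r powr \<alpha>"
    using alpha by (intro divide_left_mono[of 1 \<alpha>, simplified]) (auto simp: divide_le_eq mult_le_cancel_left1)
  also have "\<dots> = (Lam * r powr \<alpha> * B powr (1 - 1 / k)) powr k"
  proof -
    have "(r powr \<alpha>) powr k = (r powr \<alpha>) powr (k - 1) * r powr \<alpha>"
      using r by (simp add: powr_diff)
    moreover have "(B powr (1 - 1 / k)) powr k = B powr (k - 1)"
      using k by (simp add: powr_powr algebra_simps)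
    ultimately show ?thesis
      using Lam_pos r \<open>0 < B\<close> by (simp add: powr_mult)
  qed
  finally show ?thesis
    using Lam_pos k
    by (smt (verit) mult_nonneg_nonneg powr_ge_zero powr_less_mono2)
qed

section \<open>A priori bounds for \<open>u'\<close>, \<open>u''\<close> and the eigenvalue\<close>

lemma deriv_u_eq:
  assumes "r \<in> {0<..<1}"
  shows "r powr (\<alpha> - 1) * deriv u r = w r" and "r powr \<alpha> * (deriv u r / r) = w r"
  using assms by (auto simp: w_def powr_diff)

lemma deriv_u_le:
  assumes r: "r \<in> {0<..<1}"
  shows "deriv u r \<le> Lam * r"
proof -
  \<comment> \<open>\<open>B = 1\<close> is admissible because \<open>- u\<close> is at most 1 and
    \<open>s powr \<alpha>\<close> is increasing.\<close>
  have "w r \<le> Lam * r powr \<alpha> * 1 powr (1 - 1 / k)"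
  proof (rule w_le[OF r])
    fix s assume s: "0 < s" "s \<le> r"
    then have "s powr \<alpha> * (- u s) \<le> r powr \<alpha> * 1"
      using u_ge_minus_1[of s] u_neg[of s] r alpha by (intro mult_mono powr_mono2) auto
    then show "s powr \<alpha> * (- u s) \<le> r powr \<alpha> * 1" .
  qed
  then have "r powr \<alpha> * (deriv u r / r) \<le> r powr \<alpha> * Lam"
    using deriv_u_eq[OF r] by (simp add: mult.commute)
  then show ?thesis using r by (simp add: divide_le_eq)
qed

text \<open>With \<open>p = u' / r\<close> and \<open>z = u'' + (\<alpha> - 1) * p\<close>,
  convexity gives \<open>0 \<le> z\<close>, and inserting \<open>w_powr_ge\<close> into the equation
  gives \<open>z \<le> \<alpha> * p\<close>. So \<open>u''\<close> lies between
  \<open>- (\<alpha> - 1) * p\<close> and \<open>p\<close>, and \<open>p\<close> is at most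
  \<open>Lam\<close>.\<close>

lemma abs_deriv2_u_le:
  assumes r: "r \<in> {0<..<1}"
  shows "\<bar>deriv (deriv u) r\<bar> \<le> \<alpha> * Lam"
proof -
  define p where "p = deriv u r / r"
  define z where "z = deriv (deriv u) r + (\<alpha> - 1) * p"
  have p: "0 < p" "p \<le> Lam"
    using deriv_u_pos[OF r] deriv_u_le[OF r] r by (auto simp: p_def divide_le_eq)
  have "0 \<le> z" using alpha_convex r by (simp add: alpha_convex_def z_def p_def)
  have n: "0 < \<alpha> * k" using alpha k by simp
  have w: "0 < w r" by (rule w_pos[OF r])
  have "k * w r powr (k - 1) * (r powr (\<alpha> - 1) * z) = (Lam * (- u r)) powr k * r powr (\<alpha> * k - 1)"
    using eigen_ode_w[OF r] by (simp only: z_def p_def)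
  also have "\<dots> = (Lam * (- u r)) powr k * r powr (\<alpha> * k) / r"
    using r by (simp add: powr_diff)
  also have "\<dots> \<le> w r powr k * (\<alpha> * k) / r"
  proof (rule divide_right_mono)
    show "(Lam * (- u r)) powr k * r powr (\<alpha> * k) \<le> w r powr k * (\<alpha> * k)"
      using w_powr_ge[OF r] n by (simp only: pos_divide_le_eq)
  qed (use r in simp)
  also have "w r powr k = w r powr (k - 1) * (r powr (\<alpha> - 1) * r * p)"
  proof -
    have "r powr (\<alpha> - 1) * r * p = w r" using r by (simp add: p_def w_def)
    then show ?thesis using w by (simp add: powr_diff)
  qed
  also have "w r powr (k - 1) * (r powr (\<alpha> - 1) * r * p) * (\<alpha> * k) / r
      = k * w r powr (k - 1) * (r powr (\<alpha> - 1) * (\<alpha> * p))"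
    using r by simp
  finally have "z \<le> \<alpha> * p"
    using r w k by simp
  then have "deriv (deriv u) r \<le> p" by (simp add: z_def algebra_simps)
  moreover have "p \<le> \<alpha> * p" using alpha p by simp
  moreover have "(\<alpha> - 1) * p \<le> \<alpha> * p" using p by (simp add: algebra_simps)
  moreover have "\<alpha> * p \<le> \<alpha> * Lam" using p alpha by simp
  ultimately show ?thesis using \<open>0 \<le> z\<close> unfolding z_def by linarith
qed

lemma deriv_u_lipschitz: "(\<alpha> * Lam)-lipschitz_on {0<..<1} (deriv u)"
  using alpha Lam_pos abs_deriv2_u_le
  by (intro lipschitz_on_of_bounded_derivative[of _ _ _ "deriv (deriv u)"]
      has_field_derivative_at_within[OF u_deriv2]) auto

text \<open>By the mean value theorem on \<open>{1 / 2..1}\<close>, \<open>u'\<close> equals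
  \<open>2 * (- u (1 / 2))\<close> at some \<open>\<xi>\<close>. The lower bound \<open>w_ge\<close>
  at \<open>s = 1 / 2\<close> contains the same value \<open>- u (1 / 2)\<close>, which cancels. The
  bound stays bounded as \<open>k\<close> grows.\<close>

lemma Lam_le: "Lam \<le> 2 * 2 powr \<alpha> * (\<alpha> * k) powr (1 / k)"
proof -
  obtain \<xi> where \<xi>: "1 / 2 < \<xi>" "\<xi> < 1" "u 1 - u (1 / 2) = (1 - 1 / 2) * deriv u \<xi>"
  proof (rule mvt[of "1 / 2" 1 u "\<lambda>x. (*) (deriv u x)"])
    show "continuous_on {1 / 2..1} u" by (rule continuous_on_subset[OF continuous_on_u]) auto
    show "(u has_derivative (*) (deriv u x)) (at x)" if "1 / 2 < x" "x < 1" for x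
      using u_deriv[of x] that by (simp add: has_field_derivative_def)
  qed (simp_all add: mult.commute)
  let ?N = "(\<alpha> * k) powr (1 / k)"
  have \<xi>': "\<xi> \<in> {0<..<1}" using \<xi> by auto
  have "Lam * ((1 / 2) powr \<alpha> * (- u (1 / 2))) \<le> w \<xi> * ?N"
    using w_ge[of "1 / 2" \<xi>] \<xi> by simp
  also have "w \<xi> * ?N \<le> (1 * deriv u \<xi>) * ?N"
    unfolding w_def using \<xi> alpha deriv_u_pos[OF \<xi>'] by (intro mult_right_mono powr_le1) auto
  also have "1 * deriv u \<xi> = 2 * (- u (1 / 2))" using \<xi> by (simp add: u_1)
  finally have "(Lam * (1 / 2) powr \<alpha>) * (- u (1 / 2)) \<le> (2 * ?N) * (- u (1 / 2))"
    by (simp add: mult_ac)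
  moreover have "0 < - u (1 / 2)" using u_neg[of "1 / 2"] by simp
  ultimately have "Lam * (1 / 2) powr \<alpha> \<le> 2 * ?N" by (rule mult_right_le_imp_le)
  then show ?thesis by (simp add: powr_divide divide_le_eq mult_ac)
qed

subsection \<open>Comparison with the limit equation\<close>

text \<open>\<open>V_le\<close> and \<open>V_eq\<close> together say that
  \<open>r powr (\<alpha> - 1) * Vd r\<close> is the maximum of
  \<open>Lam * (s powr \<alpha> * (- V s))\<close> over \<open>0 < s \<le> r\<close>, that is,
  \<open>V\<close> solves the limit equation with the same \<open>Lam\<close> as
  \<open>u\<close>.\<close>

context
  fixes V Vd :: "real \<Rightarrow> real" and \<epsilon> :: real
  assumes V_cont: "continuous_on {0..1} V" and V_0: "V 0 = -1"
    and V_deriv: "\<And>r. r \<in> {0<..<1} \<Longrightarrow> (V has_real_derivative Vd r) (at r)"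
    and V_le: "\<And>s r. 0 < s \<Longrightarrow> s \<le> r \<Longrightarrow> r < 1 \<Longrightarrow>
        Lam * (s powr \<alpha> * (- V s)) \<le> r powr (\<alpha> - 1) * Vd r"
    and V_eq: "\<And>r. r \<in> {0<..<1} \<Longrightarrow>
        \<exists>s. 0 < s \<and> s \<le> r \<and> Lam * (s powr \<alpha> * (- V s)) = r powr (\<alpha> - 1) * Vd r"
    and eps: "1 / k \<le> \<epsilon>" "(\<alpha> * k) powr (1 / k) - 1 \<le> \<epsilon>"
begin

text \<open>The maximum in the limit equation changes by at most
  \<open>Lam * r powr \<alpha> * D\<close> when \<open>V\<close> is replaced by \<open>u\<close>;
  \<open>w_le\<close> and \<open>w_ge\<close> relate the maximum for \<open>u\<close> to
  \<open>w\<close> up to errors controlled by \<open>\<epsilon>\<close>.\<close>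

lemma deriv_diff_le:
  assumes r: "r \<in> {0<..<1}" and D: "\<And>s. 0 < s \<Longrightarrow> s \<le> r \<Longrightarrow> \<bar>u s - V s\<bar> \<le> D"
  shows "\<bar>deriv u r - Vd r\<bar> \<le> Lam * r * (D + \<epsilon>)"
proof -
  let ?R = "r powr (\<alpha> - 1)"
  have R: "0 < ?R" and Rr: "r powr \<alpha> = ?R * r" using r by (auto simp: powr_diff)
  have D0: "0 \<le> D" using D[of r] r by auto
  have sr: "s powr \<alpha> \<le> r powr \<alpha>" if "0 < s" "s \<le> r" for s
    using that alpha by (intro powr_mono2) auto
  have "deriv u r \<le> Vd r + Lam * r * (D + \<epsilon>)"
  proof -
    \<comment> \<open>Chosen so that \<open>r powr \<alpha> * B\<close> is the bound of
      \<open>V_le\<close> divided by \<open>Lam\<close>, plus the error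
      \<open>r powr \<alpha> * D\<close>.\<close>
    define B where "B = Vd r / (Lam * r) + D"
    have B: "s powr \<alpha> * (- u s) \<le> r powr \<alpha> * B" if s: "0 < s" "s \<le> r" for s
    proof -
      have "s powr \<alpha> * (- u s) \<le> s powr \<alpha> * (- V s + D)"
        using D[OF s] by (intro mult_left_mono) auto
      also have "\<dots> = s powr \<alpha> * (- V s) + s powr \<alpha> * D" by (simp add: algebra_simps)
      also have "\<dots> \<le> ?R * Vd r / Lam + r powr \<alpha> * D"
        using V_le[OF s] r Lam_pos sr[OF s] D0
        by (intro add_mono mult_right_mono) (auto simp: le_divide_eq mult_ac)
      also have "\<dots> = r powr \<alpha> * B"
        using r Lam_pos unfolding B_def Rr by (simp add: field_simps)
      finally show ?thesis .
    qed
    have "0 < r powr \<alpha> * (- u r)" using r u_neg[OF r] by (intro mult_pos_pos) auto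
    also have "\<dots> \<le> r powr \<alpha> * B" using B[of r] r by simp
    finally have "0 < B" using r by (simp add: zero_less_mult_iff)
    \<comment> \<open>Weighted AM-GM of \<open>B\<close> and 1 removes the exponent at the price of
      \<open>1 / k\<close>, whether \<open>B\<close> is below or above 1.\<close>
    have "B powr (1 - 1 / k) * 1 powr (1 / k) \<le> (1 - 1 / k) * B + 1 / k * 1"
      using k \<open>0 < B\<close> by (intro Youngs_inequality_0) auto
    also have "\<dots> \<le> B + \<epsilon>"
      using eps k \<open>0 < B\<close> by (intro add_mono mult_left_le_one_le) auto
    finally have "Lam * r powr \<alpha> * B powr (1 - 1 / k) \<le> Lam * r powr \<alpha> * (B + \<epsilon>)"
      using Lam_pos by (intro mult_left_mono) auto
    with w_le[OF r B] have "?R * deriv u r \<le> ?R * (Lam * r * (B + \<epsilon>))"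
      unfolding deriv_u_eq(1)[OF r] Rr by (simp add: mult_ac)
    then have "deriv u r \<le> Lam * r * (B + \<epsilon>)" using R by simp
    also have "\<dots> = Vd r + Lam * r * (D + \<epsilon>)"
      using r Lam_pos unfolding B_def by (simp add: field_simps)
    finally show ?thesis .
  qed
  moreover have "Vd r \<le> deriv u r + Lam * r * (D + \<epsilon>)"
  proof -
    let ?N = "(\<alpha> * k) powr (1 / k)"
    obtain s where s: "0 < s" "s \<le> r" and eq: "Lam * (s powr \<alpha> * (- V s)) = ?R * Vd r"
      using V_eq[OF r] by auto
    have "?R * Vd r \<le> Lam * (s powr \<alpha> * (- u s + D))"
      unfolding eq[symmetric] using D[OF s] Lam_pos by (intro mult_left_mono) auto
    also have "\<dots> = Lam * (s powr \<alpha> * (- u s)) + Lam * (s powr \<alpha> * D)"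
      by (simp add: algebra_simps)
    also have "\<dots> \<le> w r * ?N + Lam * (r powr \<alpha> * D)"
      using w_ge[OF s] r Lam_pos sr[OF s] D0 by (intro add_mono mult_left_mono mult_right_mono) auto
    also have "\<dots> = ?R * (deriv u r * ?N + Lam * r * D)"
      unfolding deriv_u_eq(1)[OF r, symmetric] Rr by (simp add: algebra_simps)
    finally have "Vd r \<le> deriv u r * ?N + Lam * r * D" using R by simp
    \<comment> \<open>The surplus of the factor \<open>?N\<close> over 1 is turned into an additive
      error by the a priori bound \<open>u' \<le> Lam * r\<close>.\<close>
    moreover have "deriv u r * (?N - 1) \<le> Lam * r * \<epsilon>"
    proof -
      have "deriv u r * (?N - 1) \<le> deriv u r * \<epsilon>"
        using eps deriv_u_pos[OF r] by (intro mult_left_mono) auto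
      also have "\<dots> \<le> Lam * r * \<epsilon>"
        using deriv_u_le[OF r] eps k by (intro mult_right_mono) (auto intro: order_trans[of _ "1 / k"])
      finally show ?thesis .
    qed
    ultimately show ?thesis by (simp add: algebra_simps)
  qed
  ultimately show ?thesis by linarith
qed

text \<open>The weight \<open>exp (- Lam * r\<^sup>2)\<close> turns the Volterra-type estimate of the previous lemma into a
  contraction with factor \<open>1 / 2\<close>, which replaces Gronwall's inequality.\<close>

lemma diff_le:
  assumes "r \<in> {0..1}"
  shows "\<bar>u r - V r\<bar> \<le> Lam * \<epsilon> * exp Lam"
proof -
  let ?h = "\<lambda>r. \<bar>u r - V r\<bar> * exp (- (Lam * r\<^sup>2))"
  have "continuous_on {0..1} ?h"
    by (intro continuous_intros continuous_on_u V_cont)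
  then obtain q where q: "q \<in> {0..1}" and max: "\<And>r. r \<in> {0..1} \<Longrightarrow> ?h r \<le> ?h q"
    using continuous_attains_sup[of "{0..1::real}" ?h] by auto
  define K where "K = ?h q"
  have K0: "0 \<le> K" by (simp add: K_def)
  have e0: "0 \<le> \<epsilon>" using eps k by (auto intro: order_trans[of _ "1 / k"])
  have K: "\<bar>u r - V r\<bar> \<le> K * exp (Lam * r\<^sup>2)" if "r \<in> {0..1}" for r
    using max[OF that] by (simp add: K_def exp_minus field_simps)
  have "K \<le> Lam * \<epsilon>"
  proof (cases "q = 0")
    case True
    then show ?thesis using e0 Lam_pos by (simp add: K_def u_0 V_0)
  next
    case False
    \<comment> \<open>A primitive of the bound on \<open>\<bar>u' - Vd\<bar>\<close> below. The
      weight has derivative \<open>2 * Lam * r\<close> times itself, whence the division by 2 that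
      yields the contraction.\<close>
    let ?g = "\<lambda>r. (Lam * \<epsilon> * r\<^sup>2 + K * exp (Lam * r\<^sup>2)) / 2"
    have bound: "\<bar>deriv u r - Vd r\<bar> \<le> Lam * r * (\<epsilon> + K * exp (Lam * r\<^sup>2))" if r: "r \<in> {0<..<1}" for r
    proof -
      have "\<bar>u s - V s\<bar> \<le> K * exp (Lam * r\<^sup>2)" if s: "0 < s" "s \<le> r" for s
      proof -
        have "\<bar>u s - V s\<bar> \<le> K * exp (Lam * s\<^sup>2)" using K[of s] s r by simp
        also have "\<dots> \<le> K * exp (Lam * r\<^sup>2)"
          using s Lam_pos K0 by (intro mult_left_mono) auto
        finally show ?thesis .
      qed
      from deriv_diff_le[OF r this] show ?thesis by (simp add: add.commute)
    qed
    have g: "(?g has_real_derivative Lam * r * (\<epsilon> + K * exp (Lam * r\<^sup>2))) (at r)" for r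
      by (auto intro!: derivative_eq_intros simp: algebra_simps)
    \<comment> \<open>Both signs of \<open>\<sigma>\<close> together bound the absolute
      value.\<close>
    have mono: "\<sigma> * (u 0 - V 0) - ?g 0 \<ge> \<sigma> * (u q - V q) - ?g q" if "\<bar>\<sigma>\<bar> = 1" for \<sigma>
    proof (rule DERIV_nonpos_imp_decreasing_open[of 0 q "\<lambda>r. \<sigma> * (u r - V r) - ?g r"])
      fix r assume r: "0 < r" "r < q"
      then have r': "r \<in> {0<..<1}" using q by auto
      have "\<bar>\<sigma> * (deriv u r - Vd r)\<bar> \<le> Lam * r * (\<epsilon> + K * exp (Lam * r\<^sup>2))"
        using bound[OF r'] that by (simp add: abs_mult)
      then show "\<exists>y. ((\<lambda>r. \<sigma> * (u r - V r) - ?g r) has_real_derivative y) (at r) \<and> y \<le> 0"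
        by (intro exI[of _ "\<sigma> * (deriv u r - Vd r) - Lam * r * (\<epsilon> + K * exp (Lam * r\<^sup>2))"] conjI
          DERIV_diff DERIV_cmult u_deriv[OF r'] V_deriv[OF r'] g) auto
    next
      show "continuous_on {0..q} (\<lambda>r. \<sigma> * (u r - V r) - ?g r)"
        using q by (intro continuous_intros continuous_on_subset[OF continuous_on_u]
          continuous_on_subset[OF V_cont]) auto
    qed (use q in auto)
    have "\<bar>u q - V q\<bar> \<le> ?g q - ?g 0"
      using mono[of 1] mono[of "-1"] by (simp add: u_0 V_0)
    also have "\<dots> \<le> Lam * \<epsilon> * q\<^sup>2 / 2 + K * exp (Lam * q\<^sup>2) / 2"
      using K0 by (simp add: field_simps)
    \<comment> \<open>Since the weighted difference is maximal at \<open>q\<close>, half of the left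
      side reappears on the right and can be absorbed.\<close>
    also have "K * exp (Lam * q\<^sup>2) = \<bar>u q - V q\<bar>"
      by (simp add: K_def exp_minus)
    finally have "\<bar>u q - V q\<bar> \<le> Lam * \<epsilon> * q\<^sup>2" by simp
    also have "\<dots> \<le> Lam * \<epsilon>"
      using q Lam_pos e0 by (simp add: mult_left_le power_le_one)
    finally have "\<bar>u q - V q\<bar> \<le> Lam * \<epsilon>" .
    moreover have "K \<le> \<bar>u q - V q\<bar>"
      unfolding K_def using Lam_pos by (intro mult_left_le) auto
    ultimately show ?thesis by simp
  qed
  have "\<bar>u r - V r\<bar> \<le> K * exp (Lam * r\<^sup>2)" by (rule K[OF assms])
  also have "\<dots> \<le> Lam * \<epsilon> * exp Lam"
    using \<open>K \<le> Lam * \<epsilon>\<close> K0 Lam_pos assms e0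
    by (intro mult_mono) (auto simp: mult_left_le power_le_one)
  finally show ?thesis .
qed

lemma deriv_diff_le_uniform:
  assumes r: "r \<in> {0<..<1}"
  shows "\<bar>deriv u r - Vd r\<bar> \<le> Lam * (Lam * \<epsilon> * exp Lam + \<epsilon>)"
proof -
  have e0: "0 \<le> \<epsilon>" using eps k by (auto intro: order_trans[of _ "1 / k"])
  have "\<bar>deriv u r - Vd r\<bar> \<le> Lam * r * (Lam * \<epsilon> * exp Lam + \<epsilon>)"
    using r by (intro deriv_diff_le diff_le) auto
  also have "\<dots> \<le> Lam * 1 * (Lam * \<epsilon> * exp Lam + \<epsilon>)"
    using r Lam_pos e0 by (intro mult_right_mono mult_left_mono) auto
  finally show ?thesis by simp
qed

end

end

section \<open>The limit profile\<close>

text \<open>The radius where the two branches of \<open>v_lim\<close> meet. The value for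
  \<open>\<alpha> = 2\<close> is the limit of \<open>r_crit \<alpha>\<close> as \<alpha> tends to
  2.\<close>

definition crit_radius :: "real \<Rightarrow> real" where
  "crit_radius \<alpha> = (if \<alpha> = 2 then exp (- 1 / 2) else r_crit \<alpha>)"

text \<open>The value of \<open>Lam\<close> for which \<open>v_lim \<alpha>\<close> itself solves
  the limit equation.\<close>

definition lim_eigenvalue :: "real \<Rightarrow> real" where
  "lim_eigenvalue \<alpha> = \<alpha> / (crit_radius \<alpha>)\<^sup>2"

definition v_lim_deriv :: "real \<Rightarrow> real \<Rightarrow> real" where
  "v_lim_deriv \<alpha> r =
     (if r \<le> crit_radius \<alpha> then lim_eigenvalue \<alpha> * r * exp (- (lim_eigenvalue \<alpha> * r\<^sup>2 / 2))
      else 2 * exp (- \<alpha> / 2) * r powr (1 - \<alpha>))"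

text \<open>The outer formula without its case distinction in \<open>r\<close>, so that it can be
  differentiated at the critical radius too.\<close>

definition outer_branch :: "real \<Rightarrow> real \<Rightarrow> real" where
  "outer_branch \<alpha> r = (if \<alpha> = 2 then 2 * exp (- 1) * ln r else A_coeff \<alpha> * (r powr (2 - \<alpha>) - 1))"

context
  fixes \<alpha> :: real
  assumes alpha: "1 \<le> \<alpha>"
begin

private abbreviation (input) "R \<equiv> crit_radius \<alpha>"
private abbreviation (input) "L \<equiv> lim_eigenvalue \<alpha>"
private abbreviation (input) "C \<equiv> 2 * exp (- \<alpha> / 2)"

section \<open>Identities for the critical radius\<close>

lemma crit_radius_pos: "0 < R"
  using alpha by (simp add: crit_radius_def r_crit_def)

lemma lim_eigenvalue_pos: "0 < L"
  using alpha crit_radius_pos by (simp add: lim_eigenvalue_def)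

lemma lim_eigenvalue_crit_radius: "L * R\<^sup>2 = \<alpha>"
  using crit_radius_pos by (simp add: lim_eigenvalue_def)

lemma crit_radius_powr: "R powr (2 - \<alpha>) = \<alpha> / 2"
  using alpha by (simp add: crit_radius_def r_crit_def powr_powr)

lemma lim_eigenvalue_crit_radius_powr: "L * R powr \<alpha> = 2"
proof -
  have "R powr \<alpha> * R powr (2 - \<alpha>) = R\<^sup>2"
    using crit_radius_pos by (simp flip: powr_add)
  then have "L * R powr \<alpha> * (\<alpha> / 2) = \<alpha>"
    using lim_eigenvalue_crit_radius by (simp add: crit_radius_powr mult.assoc)
  then show ?thesis using alpha by simp
qed

lemma crit_radius_less_1: "R < 1"
proof (cases "\<alpha> = 2")
  case False
  \<comment> \<open>Both factors change sign as \<alpha> passes 2, so the product stays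
    negative.\<close>
  have "(1 / (2 - \<alpha>)) * ln (\<alpha> / 2) < 0"
    using alpha False by (cases "\<alpha> < 2") (auto simp: divide_less_0_iff ln_less_zero_iff)
  then show ?thesis
    using alpha False by (simp add: crit_radius_def r_crit_def powr_def)
qed (simp add: crit_radius_def)

section \<open>Matching of the two branches and differentiability of the profile\<close>

lemma v_lim_inner: "r \<le> R \<Longrightarrow> v_lim \<alpha> r = - exp (- (L * r\<^sup>2 / 2))"
  using exp_double[of "- 1 / 2 :: real"]
  by (auto simp: v_lim_def crit_radius_def lim_eigenvalue_def exp_minus divide_simps)

lemma v_lim_outer:
  assumes "R \<le> r"
  shows "v_lim \<alpha> r = outer_branch \<alpha> r"
proof (cases "r = R")
  case True
  \<comment> \<open>Both branches take the value \<open>- exp (- \<alpha> / 2)\<close> at the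
    critical radius.\<close>
  have "outer_branch \<alpha> R = - exp (- (\<alpha> / 2))"
  proof (cases "\<alpha> = 2")
    case False
    then have "outer_branch \<alpha> R = 2 / (2 - \<alpha>) * exp (- \<alpha> / 2) * (\<alpha> / 2 - 1)"
      by (simp add: outer_branch_def crit_radius_powr A_coeff_def)
    also have "\<dots> = - exp (- (\<alpha> / 2))" using False by (simp add: field_simps)
    finally show ?thesis .
  qed (simp add: outer_branch_def crit_radius_def)
  then show ?thesis
    using True by (simp add: v_lim_inner lim_eigenvalue_crit_radius)
next
  case False
  with assms show ?thesis by (auto simp: v_lim_def outer_branch_def crit_radius_def)
qed

lemma v_lim_0: "v_lim \<alpha> 0 = -1"
  using crit_radius_pos by (simp add: v_lim_inner)

lemma v_lim_1: "v_lim \<alpha> 1 = 0"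
  using crit_radius_less_1 by (simp add: v_lim_outer outer_branch_def)

lemma outer_branch_deriv:
  assumes "0 < r"
  shows "(outer_branch \<alpha> has_real_derivative C * r powr (1 - \<alpha>)) (at r)"
proof (cases "\<alpha> = 2")
  case True
  then have "outer_branch \<alpha> = (\<lambda>r. 2 * exp (- 1) * ln r)" by (auto simp: outer_branch_def)
  then show ?thesis
    using assms True by (auto intro!: derivative_eq_intros simp: powr_minus divide_simps)
next
  case False
  then have "outer_branch \<alpha> = (\<lambda>r. A_coeff \<alpha> * (r powr (2 - \<alpha>) - 1))" by (auto simp: outer_branch_def)
  moreover have "((\<lambda>r. A_coeff \<alpha> * (r powr (2 - \<alpha>) - 1)) has_real_derivative
      A_coeff \<alpha> * ((2 - \<alpha>) * r powr (2 - \<alpha> - 1) - 0)) (at r)"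
    using assms by (intro DERIV_cmult DERIV_diff has_real_derivative_powr DERIV_const)
  moreover have "A_coeff \<alpha> * (2 - \<alpha>) = C" using False by (simp add: A_coeff_def)
  ultimately show ?thesis by (simp add: mult.assoc[symmetric])
qed

text \<open>The inner and outer derivatives agree at \<open>R\<close> because
  \<open>L * R powr \<alpha> = 2\<close>; this is the C^1 matching.\<close>

lemma v_lim_deriv_outer:
  assumes "R \<le> r"
  shows "v_lim_deriv \<alpha> r = C * r powr (1 - \<alpha>)"
proof (cases "r = R")
  case True
  have "R powr \<alpha> * R powr (1 - \<alpha>) = R" using crit_radius_pos by (simp flip: powr_add)
  then have "L * R = 2 * R powr (1 - \<alpha>)"
    using lim_eigenvalue_crit_radius_powr by (metis mult.assoc)
  then show ?thesis
    using True by (simp add: v_lim_deriv_def lim_eigenvalue_crit_radius)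
qed (use assms in \<open>simp add: v_lim_deriv_def\<close>)

lemma v_lim_has_derivative_inner:
  "((\<lambda>r. - exp (- (L * r\<^sup>2 / 2))) has_real_derivative L * r * exp (- (L * r\<^sup>2 / 2))) (at r)"
  by (auto intro!: derivative_eq_intros)

lemma v_lim_has_derivative: "(v_lim \<alpha> has_real_derivative v_lim_deriv \<alpha> r) (at r)"
proof -
  have left: "(v_lim \<alpha> has_real_derivative v_lim_deriv \<alpha> r) (at r within {..R})" if "r \<le> R" for r
  proof (rule has_field_derivative_transform_within[OF _ zero_less_one])
    show "((\<lambda>r. - exp (- (L * r\<^sup>2 / 2))) has_real_derivative v_lim_deriv \<alpha> r) (at r within {..R})"
      using has_field_derivative_at_within[OF v_lim_has_derivative_inner] that
      by (simp add: v_lim_deriv_def)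
  qed (use that in \<open>auto simp: v_lim_inner\<close>)
  have right: "(v_lim \<alpha> has_real_derivative v_lim_deriv \<alpha> r) (at r within {R..})" if "R \<le> r" for r
  proof (rule has_field_derivative_transform_within[OF _ zero_less_one])
    show "(outer_branch \<alpha> has_real_derivative v_lim_deriv \<alpha> r) (at r within {R..})"
      using has_field_derivative_at_within[OF outer_branch_deriv] that crit_radius_pos
      by (simp add: v_lim_deriv_outer)
  qed (use that in \<open>auto simp: v_lim_outer\<close>)
  consider "r < R" | "r = R" | "R < r" by linarith
  then show ?thesis
  proof cases
    case 1
    then show ?thesis using left[of r] at_within_interior[of r "{..R}"] by simp
  next
    case 2
    then show ?thesis using left[of r] right[of r] by (intro has_real_derivative_from_sides) auto
  next
    case 3
    then show ?thesis using right[of r] at_within_interior[of r "{R..}"] by simp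
  qed
qed

lemma v_lim_deriv_pos: "0 < r \<Longrightarrow> 0 < v_lim_deriv \<alpha> r"
  using lim_eigenvalue_pos by (simp add: v_lim_deriv_def)

lemma v_lim_less:
  assumes "0 \<le> s" "s < r"
  shows "v_lim \<alpha> s < v_lim \<alpha> r"
proof (rule DERIV_pos_imp_increasing_open[OF \<open>s < r\<close>])
  show "\<exists>y. (v_lim \<alpha> has_real_derivative y) (at x) \<and> 0 < y" if "s < x" "x < r" for x
    using v_lim_has_derivative v_lim_deriv_pos[of x] that assms by force
  show "continuous_on {s..r} (v_lim \<alpha>)"
    using v_lim_has_derivative by (meson DERIV_isCont continuous_at_imp_continuous_on)
qed

section \<open>The moment \<open>s powr \<alpha> * (- v_lim \<alpha> s)\<close> and the limit
  equation\<close>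

lemma v_lim_moment_deriv:
  assumes "0 < s"
  shows "((\<lambda>s. s powr \<alpha> * (- v_lim \<alpha> s)) has_real_derivative
    s powr (\<alpha> - 1) * (\<alpha> * (- v_lim \<alpha> s) - s * v_lim_deriv \<alpha> s)) (at s)"
proof -
  have "((\<lambda>s. s powr \<alpha> * (- v_lim \<alpha> s)) has_real_derivative
      (\<alpha> * s powr (\<alpha> - 1)) * (- v_lim \<alpha> s) + (- v_lim_deriv \<alpha> s) * s powr \<alpha>) (at s)"
    using assms by (intro DERIV_mult has_real_derivative_powr DERIV_minus v_lim_has_derivative)
  moreover have "s powr \<alpha> = s powr (\<alpha> - 1) * s" using assms by (simp add: powr_diff)
  ultimately show ?thesis by (simp add: algebra_simps)
qed

text \<open>Up to a nonnegative factor the derivative is \<open>\<alpha> - L * x^2\<close>, which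
  changes sign exactly at \<open>R\<close>.\<close>

lemma v_lim_moment_mono:
  assumes "0 < s" "s \<le> r" "r \<le> R"
  shows "s powr \<alpha> * (- v_lim \<alpha> s) \<le> r powr \<alpha> * (- v_lim \<alpha> r)"
proof (rule DERIV_nonneg_imp_nondecreasing[of s r "\<lambda>s. s powr \<alpha> * (- v_lim \<alpha> s)"])
  fix x assume x: "s \<le> x" "x \<le> r"
  have "L * x\<^sup>2 \<le> L * R\<^sup>2"
    using x assms lim_eigenvalue_pos by (intro mult_left_mono power_mono) auto
  then have "0 \<le> (\<alpha> - L * x\<^sup>2) * exp (- (L * x\<^sup>2 / 2))"
    by (simp add: lim_eigenvalue_crit_radius)
  also have "\<dots> = \<alpha> * (- v_lim \<alpha> x) - x * v_lim_deriv \<alpha> x"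
    using x assms by (simp add: v_lim_inner v_lim_deriv_def algebra_simps power2_eq_square)
  finally have "0 \<le> x powr (\<alpha> - 1) * (\<alpha> * (- v_lim \<alpha> x) - x * v_lim_deriv \<alpha> x)"
    by (intro mult_nonneg_nonneg) auto
  then show "\<exists>y. ((\<lambda>s. s powr \<alpha> * (- v_lim \<alpha> s)) has_real_derivative y) (at x) \<and> 0 \<le> y"
    using v_lim_moment_deriv[of x] x assms by (intro exI conjI) auto
qed fact

text \<open>The bracket \<open>?h\<close> in the derivative vanishes at \<open>R\<close> and has
  derivative \<open>- 2 * C * y powr (1 - \<alpha>)\<close>, so it is nonpositive beyond
  \<open>R\<close>. Radii above 1 are included, since rescaling may reach them.\<close>

lemma v_lim_moment_antimono:
  assumes "R \<le> r"
  shows "r powr \<alpha> * (- v_lim \<alpha> r) \<le> R powr \<alpha> * (- v_lim \<alpha> R)"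
proof (rule DERIV_nonpos_imp_nonincreasing[of R r "\<lambda>s. s powr \<alpha> * (- v_lim \<alpha> s)"])
  fix x assume x: "R \<le> x" "x \<le> r"
  let ?h = "\<lambda>x. \<alpha> * (- v_lim \<alpha> x) - C * x powr (2 - \<alpha>)"
  have "?h x \<le> ?h R"
  proof (rule DERIV_nonpos_imp_nonincreasing[of R x ?h])
    fix y assume y: "R \<le> y" "y \<le> x"
    have y0: "0 < y" using y crit_radius_pos by linarith
    have "(?h has_real_derivative \<alpha> * (- v_lim_deriv \<alpha> y) - C * ((2 - \<alpha>) * y powr (2 - \<alpha> - 1))) (at y)"
      using y0 by (intro DERIV_diff DERIV_cmult DERIV_minus v_lim_has_derivative has_real_derivative_powr)
    moreover have "\<alpha> * (- v_lim_deriv \<alpha> y) - C * ((2 - \<alpha>) * y powr (2 - \<alpha> - 1))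
        = - (2 * C * y powr (1 - \<alpha>))"
      using y by (simp add: v_lim_deriv_outer algebra_simps)
    ultimately show "\<exists>d. (?h has_real_derivative d) (at y) \<and> d \<le> 0"
      by (intro exI conjI) (assumption, simp)
  qed fact
  also have "?h R = 0"
    by (simp add: v_lim_inner crit_radius_powr lim_eigenvalue_crit_radius)
  finally have "?h x \<le> 0" .
  moreover have x0: "0 < x" using x crit_radius_pos by linarith
  then have "x * v_lim_deriv \<alpha> x = C * x powr (2 - \<alpha>)"
    using x powr_add[of x 1 "1 - \<alpha>"] by (simp add: v_lim_deriv_outer)
  ultimately have "x powr (\<alpha> - 1) * (\<alpha> * (- v_lim \<alpha> x) - x * v_lim_deriv \<alpha> x) \<le> 0"
    by (intro mult_nonneg_nonpos) auto
  then show "\<exists>y. ((\<lambda>s. s powr \<alpha> * (- v_lim \<alpha> s)) has_real_derivative y) (at x) \<and> y \<le> 0"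
    using v_lim_moment_deriv[OF x0] by (intro exI conjI)
qed fact

text \<open>The running maximum of the moment over \<open>(0, r]\<close> sits at
  \<open>min r R\<close>. Beyond \<open>R\<close> both sides are the constant
  \<open>C\<close>.\<close>

lemma v_lim_moment_eq:
  assumes "0 < r"
  shows "L * (min r R powr \<alpha> * (- v_lim \<alpha> (min r R))) = r powr (\<alpha> - 1) * v_lim_deriv \<alpha> r"
proof (cases "r \<le> R")
  case True
  then show ?thesis
    using assms by (simp add: v_lim_inner v_lim_deriv_def powr_diff)
next
  case False
  have "r powr (\<alpha> - 1) * r powr (1 - \<alpha>) = 1" using assms by (simp flip: powr_add)
  then have "r powr (\<alpha> - 1) * v_lim_deriv \<alpha> r = C"
    using False by (simp add: v_lim_deriv_outer)
  also have "\<dots> = (L * R powr \<alpha>) * exp (- \<alpha> / 2)"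
    by (simp add: lim_eigenvalue_crit_radius_powr)
  finally show ?thesis
    using False by (simp add: v_lim_inner lim_eigenvalue_crit_radius)
qed

lemma v_lim_moment_le:
  assumes "0 < s" "s \<le> r"
  shows "L * (s powr \<alpha> * (- v_lim \<alpha> s)) \<le> r powr (\<alpha> - 1) * v_lim_deriv \<alpha> r"
proof -
  have "s powr \<alpha> * (- v_lim \<alpha> s) \<le> min r R powr \<alpha> * (- v_lim \<alpha> (min r R))"
  proof (cases "s \<le> R")
    case True
    then show ?thesis using assms by (intro v_lim_moment_mono) auto
  next
    case False
    then show ?thesis using assms v_lim_moment_antimono[of s] by (simp add: min_def)
  qed
  then show ?thesis
    using assms lim_eigenvalue_pos by (subst v_lim_moment_eq[symmetric]) (auto intro: mult_left_mono)
qed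

text \<open>Dilating the profile by \<open>\<rho>\<close> multiplies the constant of the limit
  equation by \<open>\<rho>^2\<close>, so every positive constant is realised; the common factor
  \<open>\<rho> powr \<alpha>\<close> cancels.\<close>

lemma v_lim_scaled_moment_le:
  assumes "0 < \<rho>" "0 < s" "s \<le> r"
  shows "L * \<rho>\<^sup>2 * (s powr \<alpha> * (- v_lim \<alpha> (\<rho> * s)))
    \<le> r powr (\<alpha> - 1) * (\<rho> * v_lim_deriv \<alpha> (\<rho> * r))"
proof -
  let ?X = "s powr \<alpha> * (- v_lim \<alpha> (\<rho> * s))" and ?Y = "r powr (\<alpha> - 1) * v_lim_deriv \<alpha> (\<rho> * r)"
  have scale: "(\<rho> * r) powr (\<alpha> - 1) = \<rho> powr \<alpha> / \<rho> * r powr (\<alpha> - 1)"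
    using assms by (simp add: powr_mult powr_diff)
  have "L * ((\<rho> * s) powr \<alpha> * (- v_lim \<alpha> (\<rho> * s)))
      \<le> (\<rho> * r) powr (\<alpha> - 1) * v_lim_deriv \<alpha> (\<rho> * r)"
    using assms by (intro v_lim_moment_le) auto
  then have "\<rho> powr \<alpha> * (L * ?X) \<le> \<rho> powr \<alpha> * (?Y / \<rho>)"
    unfolding scale powr_mult[of \<rho> s] by (simp only: mult_ac times_divide_eq_left times_divide_eq_right)
  then have "L * ?X \<le> ?Y / \<rho>" using assms(1) by (simp only: mult_le_cancel_left_pos powr_gt_zero)
  then have "\<rho>\<^sup>2 * (L * ?X) \<le> \<rho>\<^sup>2 * (?Y / \<rho>)" by (intro mult_left_mono) auto
  also have "\<rho>\<^sup>2 * (?Y / \<rho>) = \<rho> * ?Y" using assms by (simp add: power2_eq_square)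
  finally show ?thesis by (simp only: mult_ac)
qed

lemma v_lim_scaled_moment_eq:
  assumes "0 < \<rho>" "0 < r"
  shows "\<exists>s. 0 < s \<and> s \<le> r \<and> L * \<rho>\<^sup>2 * (s powr \<alpha> * (- v_lim \<alpha> (\<rho> * s)))
    = r powr (\<alpha> - 1) * (\<rho> * v_lim_deriv \<alpha> (\<rho> * r))"
proof -
  \<comment> \<open>The point with \<open>\<rho> * s = min (\<rho> * r) R\<close>, where the dilated
    moment is maximal.\<close>
  define s where "s = min r (R / \<rho>)"
  have s: "0 < s" "s \<le> r" using assms crit_radius_pos by (auto simp: s_def)
  let ?X = "s powr \<alpha> * (- v_lim \<alpha> (\<rho> * s))" and ?Y = "r powr (\<alpha> - 1) * v_lim_deriv \<alpha> (\<rho> * r)"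
  have scale: "(\<rho> * r) powr (\<alpha> - 1) = \<rho> powr \<alpha> / \<rho> * r powr (\<alpha> - 1)"
    using assms by (simp add: powr_mult powr_diff)
  have "min (\<rho> * r) R = \<rho> * s"
    using assms by (simp add: s_def min_mult_distrib_left)
  then have "L * ((\<rho> * s) powr \<alpha> * (- v_lim \<alpha> (\<rho> * s)))
      = (\<rho> * r) powr (\<alpha> - 1) * v_lim_deriv \<alpha> (\<rho> * r)"
    using assms v_lim_moment_eq[of "\<rho> * r"] by simp
  then have "\<rho> powr \<alpha> * (L * ?X) = \<rho> powr \<alpha> * (?Y / \<rho>)"
    unfolding scale powr_mult[of \<rho> s] by (simp only: mult_ac times_divide_eq_left times_divide_eq_right)
  then have "L * ?X = ?Y / \<rho>" using assms(1) by (simp only: mult_cancel_left powr_eq_0_iff) auto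
  then have "\<rho>\<^sup>2 * (L * ?X) = \<rho>\<^sup>2 * (?Y / \<rho>)" by (rule arg_cong)
  also have "\<rho>\<^sup>2 * (?Y / \<rho>) = \<rho> * ?Y" using assms by (simp add: power2_eq_square)
  finally have "L * \<rho>\<^sup>2 * ?X = r powr (\<alpha> - 1) * (\<rho> * v_lim_deriv \<alpha> (\<rho> * r))"
    by (simp only: mult_ac)
  with s show ?thesis by blast
qed

text \<open>Inside, \<open>L * r^2 \<le> \<alpha>\<close> bounds the second derivative; outside, its
  modulus is largest at \<open>R\<close>. The pieces agree at \<open>R\<close>. One \<open>B\<close>
  serves all \<open>M\<close>, as the dilation factor is not known to be at most 1.\<close>

lemma v_lim_deriv_lipschitz:
  shows "\<exists>B. \<forall>M. B-lipschitz_on {0..M} (v_lim_deriv \<alpha>)"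
proof -
  define B where "B = max (L * (1 + \<alpha>)) (C * (\<alpha> - 1) * R powr (- \<alpha>))"
  let ?f = "\<lambda>r. L * r * exp (- (L * r\<^sup>2 / 2))" and ?g = "\<lambda>r. C * r powr (1 - \<alpha>)"
  have B: "L * (1 + \<alpha>) \<le> B" "C * (\<alpha> - 1) * R powr (- \<alpha>) \<le> B" by (auto simp: B_def)
  moreover have "0 \<le> L * (1 + \<alpha>)" using lim_eigenvalue_pos alpha by simp
  ultimately have B0: "0 \<le> B" by linarith
  have f: "B-lipschitz_on {0..R} ?f"
  proof (rule lipschitz_on_of_bounded_derivative[OF _ B0])
    fix r assume r: "r \<in> {0..R}"
    show "(?f has_real_derivative L * ((1 - L * r\<^sup>2) * exp (- (L * r\<^sup>2 / 2)))) (at r within {0..R})"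
      by (auto intro!: derivative_eq_intros simp: algebra_simps power2_eq_square)
    have "L * r\<^sup>2 \<le> L * R\<^sup>2"
      using r lim_eigenvalue_pos by (intro mult_left_mono power_mono) auto
    then have x: "0 \<le> L * r\<^sup>2" "L * r\<^sup>2 \<le> \<alpha>"
      using lim_eigenvalue_pos by (auto simp: lim_eigenvalue_crit_radius)
    then have "\<bar>1 - L * r\<^sup>2\<bar> * exp (- (L * r\<^sup>2 / 2)) \<le> (1 + \<alpha>) * 1"
      using alpha by (intro mult_mono) auto
    then have "L * (\<bar>1 - L * r\<^sup>2\<bar> * exp (- (L * r\<^sup>2 / 2))) \<le> L * (1 + \<alpha>)"
      using lim_eigenvalue_pos by (intro mult_left_mono) auto
    also have "\<dots> \<le> B" by (rule B)
    finally show "\<bar>L * ((1 - L * r\<^sup>2) * exp (- (L * r\<^sup>2 / 2)))\<bar> \<le> B"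
      using lim_eigenvalue_pos by (simp add: abs_mult)
  qed simp
  have g: "B-lipschitz_on {R..M} ?g" for M
  proof (rule lipschitz_on_of_bounded_derivative[OF _ B0])
    fix r assume r: "r \<in> {R..M}"
    then have r0: "0 < r" using crit_radius_pos by auto
    show "(?g has_real_derivative C * ((1 - \<alpha>) * r powr (1 - \<alpha> - 1))) (at r within {R..M})"
      using r0 by (intro has_field_derivative_at_within[OF DERIV_cmult] has_real_derivative_powr)
    have "r powr (- \<alpha>) \<le> R powr (- \<alpha>)"
      using r crit_radius_pos alpha by (intro powr_mono2') auto
    then have "C * (\<alpha> - 1) * r powr (- \<alpha>) \<le> C * (\<alpha> - 1) * R powr (- \<alpha>)"
      using alpha by (intro mult_left_mono) auto
    also have "\<dots> \<le> B" by (rule B)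
    finally show "\<bar>C * ((1 - \<alpha>) * r powr (1 - \<alpha> - 1))\<bar> \<le> B"
      using alpha by (simp add: abs_mult mult.assoc)
  qed simp
  have "?f R = ?g R"
    using v_lim_deriv_outer[of R] by (simp add: v_lim_deriv_def)
  then have "B-lipschitz_on {0..M} (\<lambda>x. if x \<le> R then ?f x else ?g x)" for M
    by (rule lipschitz_on_concat[OF f g])
  then show ?thesis unfolding v_lim_deriv_def[abs_def] by blast
qed

end

section \<open>Hoelder norms on the unit interval\<close>

context
  fixes f g :: "real \<Rightarrow> real" and L \<beta> :: real
  assumes beta: "0 < \<beta>" "\<beta> < 1"
    and der: "\<And>x. x \<in> {0..1} \<Longrightarrow> (f has_vector_derivative g x) (at x within {0..1})"
    and lip: "L-lipschitz_on {0..1} g"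
begin

lemma deriv_within_eq: "x \<in> {0..1} \<Longrightarrow> deriv_within {0..1} f x = g x"
  using der by (intro vector_derivative_within_closed_interval) auto

text \<open>The derivative oscillates by at most \<open>2 * e\<close> and is
  \<open>L\<close>-Lipschitz; interpolation makes the seminorm small with \<open>e\<close> even
  though \<open>L\<close> is not small.\<close>

lemma C1_holder_norm_le:
  assumes f: "\<And>x. x \<in> {0..1} \<Longrightarrow> \<bar>f x\<bar> \<le> e" and g: "\<And>x. x \<in> {0..1} \<Longrightarrow> \<bar>g x\<bar> \<le> e"
  shows "C1_holder_norm {0..1} \<beta> f \<le> ennreal (2 * e + (2 * e) powr (1 - \<beta>) * L powr \<beta>)"
proof -
  have e: "0 \<le> e" using f[of 0] by auto
  have "holder_seminorm_on {0..1} \<beta> (deriv_within {0..1} f) \<le> ennreal ((2 * e) powr (1 - \<beta>) * L powr \<beta>)"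
    unfolding holder_seminorm_on_def
  proof (rule SUP_least, clarify)
    fix x y :: real assume xy: "x \<in> {0..1}" "y \<in> {0..1}" "x \<noteq> y"
    have "\<bar>g x - g y\<bar> / \<bar>x - y\<bar> powr \<beta> \<le> (2 * e) powr (1 - \<beta>) * L powr \<beta>"
      using lipschitz_onD[OF lip xy(1,2)] lipschitz_on_nonneg[OF lip] beta xy g[OF xy(1)] g[OF xy(2)]
      by (intro holder_interpolation) (auto simp: dist_real_def)
    then show "ennreal (\<bar>deriv_within {0..1} f x - deriv_within {0..1} f y\<bar> / \<bar>x - y\<bar> powr \<beta>)
        \<le> ennreal ((2 * e) powr (1 - \<beta>) * L powr \<beta>)"
      using xy by (simp add: deriv_within_eq ennreal_leI)
  qed
  moreover have "sup_norm_on {0..1} f \<le> ennreal e"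
    unfolding sup_norm_on_def using f by (intro SUP_least ennreal_leI)
  moreover have "sup_norm_on {0..1} (deriv_within {0..1} f) \<le> ennreal e"
    unfolding sup_norm_on_def using g by (intro SUP_least ennreal_leI) (simp add: deriv_within_eq)
  ultimately have "C1_holder_norm {0..1} \<beta> f
      \<le> ennreal e + ennreal e + ennreal ((2 * e) powr (1 - \<beta>) * L powr \<beta>)"
    unfolding C1_holder_norm_def by (intro add_mono)
  also have "\<dots> = ennreal (2 * e + (2 * e) powr (1 - \<beta>) * L powr \<beta>)"
    using e by (simp flip: ennreal_plus)
  finally show ?thesis .
qed

lemma C1_holder_spaceI: "f \<in> C1_holder_space {0..1} \<beta>"
proof -
  have contf: "continuous_on {0..1} f"
    using der by (meson continuous_on_eq_continuous_within has_vector_derivative_continuous)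
  have contg: "continuous_on {0..1} g"
    by (rule lipschitz_on_continuous_on[OF lip])
  have "bounded (f ` {0..1})" "bounded (g ` {0..1})"
    using contf contg by (auto intro!: compact_imp_bounded compact_continuous_image)
  then obtain A B where "\<And>x. x \<in> {0..1} \<Longrightarrow> \<bar>f x\<bar> \<le> A" "\<And>x. x \<in> {0..1} \<Longrightarrow> \<bar>g x\<bar> \<le> B"
    unfolding bounded_iff by (metis imageI real_norm_def)
  then have "C1_holder_norm {0..1} \<beta> f
      \<le> ennreal (2 * max A B + (2 * max A B) powr (1 - \<beta>) * L powr \<beta>)"
    by (intro C1_holder_norm_le) (auto simp: le_max_iff_disj)
  then have "C1_holder_norm {0..1} \<beta> f < \<infinity>"
    using ennreal_less_top le_less_trans by (metis infinity_ennreal_def)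
  moreover have "f differentiable_on {0..1}"
    unfolding differentiable_on_def using der differentiableI_vector by blast
  moreover have "continuous_on {0..1} (deriv_within {0..1} f)"
    using contg by (rule continuous_on_eq) (simp add: deriv_within_eq)
  ultimately show ?thesis by (simp add: C1_holder_space_def)
qed

end

section \<open>Convergence\<close>

theorem theorem1p2:
  fixes \<alpha> \<beta> :: real
    and u :: "real \<Rightarrow> real \<Rightarrow> real"
    and lam :: "real \<Rightarrow> real"
  assumes "1 \<le> \<alpha>" and "\<alpha> < 2 * exp 1"
    and "0 < \<beta>" and "\<beta> < 1"
    and "\<And>k. 1 \<le> k \<Longrightarrow> radial_eigenpair k (\<alpha> * k) (u k) (lam k)"
  shows "C1_holder_converges {0..1} \<beta> u (v_lim \<alpha>) at_top"
proof -
  let ?v = "v_lim \<alpha>" and ?v' = "v_lim_deriv \<alpha>" and ?\<Lambda> = "lim_eigenvalue \<alpha>"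
  define N where "N k = (\<alpha> * k) powr (1 / k)" for k
  define \<epsilon> where "\<epsilon> k = max (1 / k) (N k - 1)" for k
  define M where "M k = radial_eigenfunction.Lam \<alpha> k (lam k)" for k
  \<comment> \<open>The dilation for which the rescaled profile solves the limit equation with
    constant \<open>M k\<close>.\<close>
  define \<rho> where "\<rho> k = sqrt (M k / ?\<Lambda>)" for k
  \<comment> \<open>The bound of \<open>Lam_le\<close> once \<open>N k \<le> 2\<close>, independent
    of \<open>k\<close>.\<close>
  define P where "P = 2 * 2 powr \<alpha> * 2"
  obtain B where B: "\<And>T. B-lipschitz_on {0..T} ?v'"
    using v_lim_deriv_lipschitz[OF assms(1)] by auto
  have B0: "0 \<le> B" using lipschitz_on_nonneg[OF B] .
  have \<Lambda>: "0 < ?\<Lambda>" by (rule lim_eigenvalue_pos[OF assms(1)])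
  have v_der: "(?v has_vector_derivative ?v' x) (at x within S)" for x S
    using v_lim_has_derivative[OF assms(1)]
    by (intro has_vector_derivative_at_within[of _ _ _ S])
      (simp add: has_real_derivative_iff_has_vector_derivative)
  have v_cont: "continuous_on S ?v" for S
    using v_lim_has_derivative[OF assms(1)] by (meson DERIV_isCont continuous_at_imp_continuous_on)
  \<comment> \<open>The first term compares \<open>u'\<close> with the derivative of the dilated
    profile, the second that derivative with the one of \<open>v_lim \<alpha>\<close>.\<close>
  define e where "e k = P * (P * \<epsilon> k * exp P + \<epsilon> k) + \<bar>\<rho> k - 1\<bar> * (B * (\<rho> k + 1))" for k
  define D where "D = \<alpha> * P + B"
  have key: "0 \<le> e k \<and> \<bar>?v (\<rho> k)\<bar> \<le> P * \<epsilon> k * exp P \<and> 0 < \<rho> k \<and> u k \<in> C1_holder_space {0..1} \<beta> \<and>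
      C1_holder_norm {0..1} \<beta> (\<lambda>x. u k x - ?v x) \<le> ennreal (2 * e k + (2 * e k) powr (1 - \<beta>) * D powr \<beta>)"
    if k: "1 < k" and N: "N k \<le> 2" for k
  proof -
    interpret radial_eigenfunction \<alpha> k "u k" "lam k"
      using assms(1,5) k by unfold_locales auto
    have M: "M k = Lam" by (simp add: M_def)
    have \<rho>: "0 < \<rho> k" and \<rho>2: "?\<Lambda> * (\<rho> k)\<^sup>2 = Lam"
      using Lam_pos \<Lambda> by (auto simp: \<rho>_def M)
    have "Lam \<le> 2 * 2 powr \<alpha> * N k" using Lam_le by (simp add: N_def)
    also have "\<dots> \<le> P" unfolding P_def using N by (intro mult_left_mono) auto
    finally have LP: "Lam \<le> P" .
    have e0: "0 < \<epsilon> k" using k by (simp add: \<epsilon>_def less_max_iff_disj)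
    have P0: "0 < P" using LP Lam_pos by linarith
    let ?V = "\<lambda>r. ?v (\<rho> k * r)" and ?Vd = "\<lambda>r. \<rho> k * ?v' (\<rho> k * r)"
    have V: "continuous_on {0..1} ?V" "?V 0 = -1"
      "\<And>r. r \<in> {0<..<1} \<Longrightarrow> (?V has_real_derivative ?Vd r) (at r)"
      "\<And>s r. 0 < s \<Longrightarrow> s \<le> r \<Longrightarrow> r < 1 \<Longrightarrow> Lam * (s powr \<alpha> * (- ?V s)) \<le> r powr (\<alpha> - 1) * ?Vd r"
      "\<And>r. r \<in> {0<..<1} \<Longrightarrow>
        \<exists>s. 0 < s \<and> s \<le> r \<and> Lam * (s powr \<alpha> * (- ?V s)) = r powr (\<alpha> - 1) * ?Vd r"
      "1 / k \<le> \<epsilon> k" "(\<alpha> * k) powr (1 / k) - 1 \<le> \<epsilon> k"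
    proof -
      show "continuous_on {0..1} ?V"
        by (rule continuous_on_compose2[OF v_cont[of UNIV]]) (auto intro!: continuous_intros)
      show "?V 0 = -1" using v_lim_0[OF assms(1)] by simp
      show "(?V has_real_derivative ?Vd r) (at r)" for r
        using DERIV_chain2[OF v_lim_has_derivative[OF assms(1)] DERIV_cmult[OF DERIV_ident, of "\<rho> k"], of r UNIV]
        by (simp add: mult.commute)
      show "Lam * (s powr \<alpha> * (- ?V s)) \<le> r powr (\<alpha> - 1) * ?Vd r" if "0 < s" "s \<le> r" for s r
        using v_lim_scaled_moment_le[OF assms(1) \<rho> that] by (simp only: \<rho>2)
      show "\<exists>s. 0 < s \<and> s \<le> r \<and> Lam * (s powr \<alpha> * (- ?V s)) = r powr (\<alpha> - 1) * ?Vd r"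
        if "r \<in> {0<..<1}" for r
        using v_lim_scaled_moment_eq[OF assms(1) \<rho>, of r] that by (simp only: \<rho>2) auto
    qed (auto simp: \<epsilon>_def N_def)
    have exp_le: "Lam * \<epsilon> k * exp Lam \<le> P * \<epsilon> k * exp P"
      using LP Lam_pos P0 e0 by (intro mult_mono) auto
    have "(1::real) \<in> {0..1}" by simp
    \<comment> \<open>At \<open>r = 1\<close> the eigenfunction vanishes, so the comparison bounds
      the profile at \<open>\<rho> k\<close> itself. This is the only information used to locate
      \<open>\<rho> k\<close>.\<close>
    from diff_le[OF V this] have "\<bar>u k 1 - ?V 1\<bar> \<le> Lam * \<epsilon> k * exp Lam" .
    then have v\<rho>: "\<bar>?v (\<rho> k)\<bar> \<le> P * \<epsilon> k * exp P"
      using exp_le by (simp add: u_1)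
    obtain g where g: "(\<alpha> * Lam)-lipschitz_on {0..1} g" "\<And>x. x \<in> {0<..<1} \<Longrightarrow> g x = deriv (u k) x"
      "\<And>x. x \<in> {0..1} \<Longrightarrow> (u k has_vector_derivative g x) (at x within {0..1})"
      using derivative_extends_to_closed_interval[OF zero_less_one continuous_on_u u_deriv deriv_u_lipschitz]
      by metis
    have interior: "\<bar>g x - ?v' x\<bar> \<le> e k" if x: "x \<in> {0<..<1}" for x
    proof -
      have "\<bar>deriv (u k) x - ?Vd x\<bar> \<le> Lam * (Lam * \<epsilon> k * exp Lam + \<epsilon> k)"
        by (rule deriv_diff_le_uniform[OF V x])
      also have "\<dots> \<le> P * (P * \<epsilon> k * exp P + \<epsilon> k)"
        using LP Lam_pos P0 e0 exp_le by (intro mult_mono add_mono) auto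
      finally have 1: "\<bar>g x - ?Vd x\<bar> \<le> P * (P * \<epsilon> k * exp P + \<epsilon> k)"
        using g(2)[OF x] by simp
      \<comment> \<open>The interval must contain both \<open>x\<close> and
        \<open>\<rho> k * x\<close>; its length does not affect \<open>B\<close>.\<close>
      have \<rho>x: "\<rho> k * x \<in> {0..max 1 (\<rho> k)}" "x \<in> {0..max 1 (\<rho> k)}" "0 \<in> {0..max 1 (\<rho> k)}"
        using x \<rho> by (auto simp: le_max_iff_disj mult_left_le)
      have v'0: "?v' 0 = 0" using crit_radius_pos[OF assms(1)] by (simp add: v_lim_deriv_def)
      have "\<bar>?v' (\<rho> k * x)\<bar> \<le> B * (\<rho> k * x)"
        using lipschitz_onD[OF B \<rho>x(1,3)] x \<rho> by (simp add: dist_real_def v'0)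
      also have "\<dots> \<le> B * \<rho> k" using x \<rho> B0 by (intro mult_left_mono) (auto simp: mult_left_le)
      finally have "\<bar>\<rho> k - 1\<bar> * \<bar>?v' (\<rho> k * x)\<bar> \<le> \<bar>\<rho> k - 1\<bar> * (B * \<rho> k)"
        by (intro mult_left_mono) auto
      moreover have "\<bar>?v' (\<rho> k * x) - ?v' x\<bar> \<le> \<bar>\<rho> k - 1\<bar> * B"
      proof -
        have "\<bar>?v' (\<rho> k * x) - ?v' x\<bar> \<le> B * \<bar>\<rho> k * x - x\<bar>"
          using lipschitz_onD[OF B \<rho>x(1,2)] by (simp add: dist_real_def)
        also have "\<bar>\<rho> k * x - x\<bar> = \<bar>\<rho> k - 1\<bar> * x"
          using x abs_mult[of "\<rho> k - 1" x] by (simp add: left_diff_distrib)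
        also have "B * (\<bar>\<rho> k - 1\<bar> * x) \<le> B * (\<bar>\<rho> k - 1\<bar> * 1)"
          using x B0 by (intro mult_left_mono) auto
        finally show ?thesis by (simp add: mult.commute)
      qed
      moreover have "?Vd x - ?v' x = (\<rho> k - 1) * ?v' (\<rho> k * x) + (?v' (\<rho> k * x) - ?v' x)"
        by (simp add: algebra_simps)
      then have "\<bar>?Vd x - ?v' x\<bar> \<le> \<bar>\<rho> k - 1\<bar> * \<bar>?v' (\<rho> k * x)\<bar> + \<bar>?v' (\<rho> k * x) - ?v' x\<bar>"
        by (metis abs_mult abs_triangle_ineq)
      ultimately have "\<bar>?Vd x - ?v' x\<bar> \<le> \<bar>\<rho> k - 1\<bar> * (B * (\<rho> k + 1))"
        by (simp add: algebra_simps)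
      with 1 show ?thesis unfolding e_def by linarith
    qed
    have lip: "D-lipschitz_on {0..1} (\<lambda>x. g x - ?v' x)"
      using assms(1) LP unfolding D_def
      by (intro lipschitz_on_le[OF lipschitz_on_diff[OF g(1) B]] add_right_mono mult_left_mono) auto
    \<comment> \<open>The estimate passes to the endpoints by continuity of the extended
      derivative.\<close>
    have bound: "\<bar>g x - ?v' x\<bar> \<le> e k" if "x \<in> {0..1}" for x
      using continuous_le_on_closure[of "{0<..<1}" "\<lambda>x. \<bar>g x - ?v' x\<bar>" x "e k"] interior that
        continuous_on_rabs[OF lipschitz_on_continuous_on[OF lip]] by simp
    have der: "((\<lambda>x. u k x - ?v x) has_vector_derivative g x - ?v' x) (at x within {0..1})"
      if "x \<in> {0..1}" for x
      by (rule has_vector_derivative_diff[OF g(3)[OF that] v_der])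
    \<comment> \<open>Both functions equal -1 at 0, so the derivative bound carries over to the
      values.\<close>
    have "\<bar>u k x - ?v x\<bar> \<le> e k" if x: "x \<in> {0..1}" for x
    proof -
      have "norm ((u k x - ?v x) - (u k 0 - ?v 0)) \<le> e k * norm (x - 0)"
        using der bound x
        by (intro field_differentiable_bound[of "{0..1}" _ "\<lambda>x. g x - ?v' x"])
          (auto simp: has_real_derivative_iff_has_vector_derivative)
      also have "\<dots> \<le> e k * 1"
        using x bound[OF x] by (intro mult_left_mono) auto
      finally show ?thesis by (simp add: u_0 v_lim_0[OF assms(1)])
    qed
    then have "C1_holder_norm {0..1} \<beta> (\<lambda>x. u k x - ?v x)
        \<le> ennreal (2 * e k + (2 * e k) powr (1 - \<beta>) * D powr \<beta>)"
      using C1_holder_norm_le[OF assms(3,4) der lip] bound by blast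
    moreover have "u k \<in> C1_holder_space {0..1} \<beta>"
      by (rule C1_holder_spaceI[OF assms(3,4) g(3,1)])
    moreover have "0 \<le> e k" using bound[of 0] by auto
    ultimately show ?thesis using v\<rho> \<rho> by blast
  qed
  have N: "(N \<longlongrightarrow> 1) at_top"
    unfolding N_def by (rule powr_inverse_tendsto_1[OF assms(1)])
  then have "\<forall>\<^sub>F k in at_top. N k < 2" by (rule order_tendstoD(2)) simp
  then have ev: "\<forall>\<^sub>F k in at_top. 1 < k \<and> N k \<le> 2"
    using eventually_gt_at_top[of 1] by eventually_elim auto
  have "((\<lambda>k. max (1 / k) (N k - 1)) \<longlongrightarrow> max 0 (1 - 1)) at_top"
    using tendsto_inverse_0_at_top[OF filterlim_ident]
    by (intro tendsto_max tendsto_diff N tendsto_const) (simp add: inverse_eq_divide)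
  then have \<epsilon>: "(\<epsilon> \<longlongrightarrow> 0) at_top" by (simp add: \<epsilon>_def[abs_def])
  then have P\<epsilon>: "((\<lambda>k. P * \<epsilon> k * exp P) \<longlongrightarrow> 0) at_top"
    by (auto intro!: tendsto_eq_intros)
  \<comment> \<open>The profile is strictly increasing on nonnegative radii with its zero at 1, so
    smallness of its value at \<open>\<rho> k\<close> forces \<open>\<rho> k\<close> close to
    1.\<close>
  have \<rho>: "(\<rho> \<longlongrightarrow> 1) at_top"
  proof (rule tendstoI)
    fix d :: real assume "0 < d"
    \<comment> \<open>The cut at 0 keeps \<open>t\<close> in the range where strict monotonicity of
      the profile is available.\<close>
    define t where "t = max 0 (1 - d)"
    have t: "0 \<le> t" "t < 1" "1 - d \<le> t" using \<open>0 < d\<close> by (auto simp: t_def)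
    have "?v t < 0" "0 < ?v (1 + d)"
      using v_lim_less[OF assms(1), of t 1] v_lim_less[OF assms(1), of 1 "1 + d"] t \<open>0 < d\<close>
      by (auto simp: v_lim_1[OF assms(1)])
    then have "\<forall>\<^sub>F k in at_top. P * \<epsilon> k * exp P < min (- ?v t) (?v (1 + d))"
      by (intro order_tendstoD(2)[OF P\<epsilon>]) simp
    with ev show "\<forall>\<^sub>F k in at_top. dist (\<rho> k) 1 < d"
    proof eventually_elim
      case (elim k)
      then have k: "\<bar>?v (\<rho> k)\<bar> < min (- ?v t) (?v (1 + d))" "0 < \<rho> k"
        using key[of k] by auto
      have "\<not> \<rho> k \<le> t"
        using k v_lim_less[OF assms(1), of "\<rho> k" t] by (cases "\<rho> k = t") auto
      moreover have "\<not> 1 + d \<le> \<rho> k"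
        using k \<open>0 < d\<close> v_lim_less[OF assms(1), of "1 + d" "\<rho> k"] by (cases "\<rho> k = 1 + d") auto
      ultimately show ?case using t by (simp add: dist_real_def abs_less_iff)
    qed
  qed
  have "((\<lambda>k. P * (P * \<epsilon> k * exp P + \<epsilon> k) + \<bar>\<rho> k - 1\<bar> * (B * (\<rho> k + 1)))
      \<longlongrightarrow> P * (P * 0 * exp P + 0) + \<bar>1 - 1\<bar> * (B * (1 + 1))) at_top"
    by (intro tendsto_intros \<epsilon> \<rho>)
  then have "(e \<longlongrightarrow> 0) at_top" by (simp add: e_def[abs_def])
  then have e: "((\<lambda>k. 2 * e k) \<longlongrightarrow> 0) at_top" by (rule tendsto_mult_right_zero)
  have "((\<lambda>k. (2 * e k) powr (1 - \<beta>)) \<longlongrightarrow> 0) at_top"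
  proof (rule tendsto_zero_powrI[OF e tendsto_const])
    show "\<forall>\<^sub>F k in at_top. 0 \<le> 2 * e k"
      using ev by eventually_elim (use key in auto)
  qed (use assms in auto)
  from tendsto_ennrealI[OF tendsto_add[OF e tendsto_mult_left_zero[OF this]]]
  have "((\<lambda>k. ennreal (2 * e k + (2 * e k) powr (1 - \<beta>) * D powr \<beta>)) \<longlongrightarrow> 0) at_top"
    by simp
  then have "((\<lambda>k. C1_holder_norm {0..1} \<beta> (\<lambda>x. u k x - ?v x)) \<longlongrightarrow> 0) at_top"
  proof (rule tendsto_sandwich[OF _ _ tendsto_const, rotated 2])
    show "\<forall>\<^sub>F k in at_top. C1_holder_norm {0..1} \<beta> (\<lambda>x. u k x - ?v x)
        \<le> ennreal (2 * e k + (2 * e k) powr (1 - \<beta>) * D powr \<beta>)"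
      using ev by eventually_elim (use key in blast)
  qed simp
  moreover have "\<forall>\<^sub>F k in at_top. u k \<in> C1_holder_space {0..1} \<beta>"
    using ev by eventually_elim (use key in blast)
  moreover have "?v \<in> C1_holder_space {0..1} \<beta>"
    by (rule C1_holder_spaceI[OF assms(3,4) v_der B])
  ultimately show ?thesis by (simp add: C1_holder_converges_def)
qed

end
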